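(* Let $R$ be a ring, let $S$ be any set of finitely presented left $R$-modules and let $M$ be a left $R$-module. Suppose that every $S$-pure submodule $M_0$ of $M$ for which $M/M_0$ is indecomposable is a direct summand of $M$. Then every $S$-pure submodule of $M$ is a direct summand of $M$, and $M$ is a direct sum of indecomposable submodules.
   Context: Rings are associative with unity and modules are unital. A short exact sequence $0\to A\to B\to C\to 0$ of left $R$-modules is $S$-pure if $0\to \mathrm{Hom}_R(X,A)\to \mathrm{Hom}_R(X,B)\to \mathrm{Hom}_R(X,C)\to 0$ is exact for all $X\in S$. A submodule $N\le M$ is an $S$-pure submodule if $0\to N\to M\to M/N\to 0$ is $S$-pure. *)

theory Defs
  imports "HOL-Algebra.Module" "HOL-Algebra.AbelCoset"
begin

text \<open>The library locale \<open>module\<close> asks for a commutative ring of scalars, so left modules over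
  an arbitrary ring are introduced here, on the same record type. The fields \<open>mult\<close> and \<open>one\<close>
  which that record inherits from \<open>ring\<close> play no role for modules.\<close>

locale left_module = R?: ring R + M?: abelian_group M
  for R (structure) and M :: "('r, 'm, 'k) module_scheme" (structure) +
  assumes smult_closed: "\<lbrakk>a \<in> carrier R; x \<in> carrier M\<rbrakk> \<Longrightarrow> a \<odot>\<^bsub>M\<^esub> x \<in> carrier M"
    and smult_l_distr: "\<lbrakk>a \<in> carrier R; b \<in> carrier R; x \<in> carrier M\<rbrakk> \<Longrightarrow>
      (a \<oplus>\<^bsub>R\<^esub> b) \<odot>\<^bsub>M\<^esub> x = a \<odot>\<^bsub>M\<^esub> x \<oplus>\<^bsub>M\<^esub> b \<odot>\<^bsub>M\<^esub> x"
    and smult_r_distr: "\<lbrakk>a \<in> carrier R; x \<in> carrier M; y \<in> carrier M\<rbrakk> \<Longrightarrow>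
      a \<odot>\<^bsub>M\<^esub> (x \<oplus>\<^bsub>M\<^esub> y) = a \<odot>\<^bsub>M\<^esub> x \<oplus>\<^bsub>M\<^esub> a \<odot>\<^bsub>M\<^esub> y"
    and smult_assoc: "\<lbrakk>a \<in> carrier R; b \<in> carrier R; x \<in> carrier M\<rbrakk> \<Longrightarrow>
      (a \<otimes>\<^bsub>R\<^esub> b) \<odot>\<^bsub>M\<^esub> x = a \<odot>\<^bsub>M\<^esub> (b \<odot>\<^bsub>M\<^esub> x)"
    and smult_one: "x \<in> carrier M \<Longrightarrow> \<one>\<^bsub>R\<^esub> \<odot>\<^bsub>M\<^esub> x = x"

text \<open>Homomorphisms are taken extensional (undefined outside the carrier), so that equality in
  \<open>Hom\<^sub>R(M,N)\<close> is equality of HOL functions.\<close>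

definition lmod_hom ::
  "('r, 'a) ring_scheme \<Rightarrow> ('r, 'm, 'b) module_scheme \<Rightarrow> ('r, 'n, 'c) module_scheme \<Rightarrow> ('m \<Rightarrow> 'n) set"
  where "lmod_hom R M N = {h \<in> carrier M \<rightarrow>\<^sub>E carrier N.
    (\<forall>x\<in>carrier M. \<forall>y\<in>carrier M. h (x \<oplus>\<^bsub>M\<^esub> y) = h x \<oplus>\<^bsub>N\<^esub> h y) \<and>
    (\<forall>a\<in>carrier R. \<forall>x\<in>carrier M. h (a \<odot>\<^bsub>M\<^esub> x) = a \<odot>\<^bsub>N\<^esub> h x)}"

definition Hom_group ::
  "('r, 'a) ring_scheme \<Rightarrow> ('r, 'm, 'b) module_scheme \<Rightarrow> ('r, 'n, 'c) module_scheme \<Rightarrow> ('m \<Rightarrow> 'n) monoid"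
  where "Hom_group R M N =
    \<lparr>carrier = lmod_hom R M N,
     mult = (\<lambda>f g. \<lambda>x\<in>carrier M. f x \<oplus>\<^bsub>N\<^esub> g x),
     one = (\<lambda>x\<in>carrier M. \<zero>\<^bsub>N\<^esub>)\<rparr>"

text \<open>The library's exact sequences force all groups to have one and the same element type,
  hence the following version.\<close>

definition short_exact ::
  "('a, 'k) monoid_scheme \<Rightarrow> ('b, 'l) monoid_scheme \<Rightarrow> ('c, 'm) monoid_scheme \<Rightarrow>
    ('a \<Rightarrow> 'b) \<Rightarrow> ('b \<Rightarrow> 'c) \<Rightarrow> bool"
  where "short_exact A B C f g \<longleftrightarrow>
    f \<in> hom A B \<and> g \<in> hom B C \<and>
    inj_on f (carrier A) \<and> f ` carrier A = kernel B C g \<and> g ` carrier B = carrier C"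

definition lmod_short_exact ::
  "('r, 'k) ring_scheme \<Rightarrow> ('r, 'a, 'p) module_scheme \<Rightarrow> ('r, 'b, 'q) module_scheme \<Rightarrow>
    ('r, 'c, 's) module_scheme \<Rightarrow> ('a \<Rightarrow> 'b) \<Rightarrow> ('b \<Rightarrow> 'c) \<Rightarrow> bool"
  where "lmod_short_exact R A B C f g \<longleftrightarrow>
    f \<in> lmod_hom R A B \<and> g \<in> lmod_hom R B C \<and>
    short_exact (add_monoid A) (add_monoid B) (add_monoid C) f g"

definition S_pure_seq ::
  "('r, 'k) ring_scheme \<Rightarrow> ('r, 'x, 'o) module_scheme set \<Rightarrow>
    ('r, 'a, 'p) module_scheme \<Rightarrow> ('r, 'b, 'q) module_scheme \<Rightarrow> ('r, 'c, 's) module_scheme \<Rightarrow>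
    ('a \<Rightarrow> 'b) \<Rightarrow> ('b \<Rightarrow> 'c) \<Rightarrow> bool"
  where "S_pure_seq R S A B C f g \<longleftrightarrow>
    lmod_short_exact R A B C f g \<and>
    (\<forall>X\<in>S. short_exact (Hom_group R X A) (Hom_group R X B) (Hom_group R X C)
       (compose (carrier X) f) (compose (carrier X) g))"

text \<open>Scalar multiplication on cosets follows the pattern of \<open>rcoset_mult\<close>; for a submodule \<open>N\<close>
  it satisfies \<open>a \<odot> (N +> x) = N +> (a \<odot> x)\<close>.\<close>

definition quotient_module :: "('r, 'm, 'k) module_scheme \<Rightarrow> 'm set \<Rightarrow> ('r, 'm set) module"
  where "quotient_module M N =
    \<lparr>carrier = a_rcosets\<^bsub>M\<^esub> N, mult = undefined, one = undefined,
     zero = N, add = set_add M,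
     smult = (\<lambda>a C. \<Union>x\<in>C. N +>\<^bsub>M\<^esub> (a \<odot>\<^bsub>M\<^esub> x))\<rparr>"

definition S_pure_submodule ::
  "('r, 'k) ring_scheme \<Rightarrow> ('r, 'x, 'o) module_scheme set \<Rightarrow> ('r, 'm, 'p) module_scheme \<Rightarrow> 'm set \<Rightarrow> bool"
  where "S_pure_submodule R S M N \<longleftrightarrow>
    submodule N R M \<and>
    S_pure_seq R S (M\<lparr>carrier := N\<rparr>) M (quotient_module M N)
      (\<lambda>x\<in>N. x) (\<lambda>x\<in>carrier M. N +>\<^bsub>M\<^esub> x)"

definition free_lmodule :: "('r, 'k) ring_scheme \<Rightarrow> nat \<Rightarrow> ('r, nat \<Rightarrow> 'r) module"
  where "free_lmodule R n =
    \<lparr>carrier = {..<n} \<rightarrow>\<^sub>E carrier R, mult = undefined, one = undefined,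
     zero = (\<lambda>i\<in>{..<n}. \<zero>\<^bsub>R\<^esub>), add = (\<lambda>u v. \<lambda>i\<in>{..<n}. u i \<oplus>\<^bsub>R\<^esub> v i),
     smult = (\<lambda>a v. \<lambda>i\<in>{..<n}. a \<otimes>\<^bsub>R\<^esub> v i)\<rparr>"

text \<open>There is an exact sequence \<open>R\<^sup>m \<rightarrow> R\<^sup>n \<rightarrow> X \<rightarrow> 0\<close>.\<close>

definition finitely_presented :: "('r, 'k) ring_scheme \<Rightarrow> ('r, 'x, 'o) module_scheme \<Rightarrow> bool"
  where "finitely_presented R X \<longleftrightarrow>
    (\<exists>m n. \<exists>f \<in> lmod_hom R (free_lmodule R m) (free_lmodule R n). \<exists>g \<in> lmod_hom R (free_lmodule R n) X.
       f ` carrier (free_lmodule R m) = a_kernel (free_lmodule R n) X g \<and>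
       g ` carrier (free_lmodule R n) = carrier X)"

definition complementary ::
  "('r, 'k) ring_scheme \<Rightarrow> ('r, 'm, 'p) module_scheme \<Rightarrow> 'm set \<Rightarrow> 'm set \<Rightarrow> bool"
  where "complementary R M N K \<longleftrightarrow>
    submodule N R M \<and> submodule K R M \<and> N <+>\<^bsub>M\<^esub> K = carrier M \<and> N \<inter> K = {\<zero>\<^bsub>M\<^esub>}"

definition direct_summand ::
  "('r, 'k) ring_scheme \<Rightarrow> ('r, 'm, 'p) module_scheme \<Rightarrow> 'm set \<Rightarrow> bool"
  where "direct_summand R M N \<longleftrightarrow> (\<exists>K. complementary R M N K)"

text \<open>As usual, the zero module does not count as indecomposable.\<close>

definition indecomposable :: "('r, 'k) ring_scheme \<Rightarrow> ('r, 'm, 'p) module_scheme \<Rightarrow> bool"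
  where "indecomposable R M \<longleftrightarrow>
    carrier M \<noteq> {\<zero>\<^bsub>M\<^esub>} \<and>
    (\<forall>N K. complementary R M N K \<longrightarrow> N = {\<zero>\<^bsub>M\<^esub>} \<or> K = {\<zero>\<^bsub>M\<^esub>})"

text \<open>Every element of \<open>M\<close> is in exactly one way a sum of elements of the \<open>N i\<close>, almost all of
  them zero. For \<open>I = {}\<close> this says that \<open>M\<close> is zero.\<close>

definition internal_direct_sum ::
  "('r, 'k) ring_scheme \<Rightarrow> ('r, 'm, 'p) module_scheme \<Rightarrow> 'i set \<Rightarrow> ('i \<Rightarrow> 'm set) \<Rightarrow> bool"
  where "internal_direct_sum R M I N \<longleftrightarrow>
    (\<forall>i\<in>I. submodule (N i) R M) \<and>
    (\<forall>x\<in>carrier M. \<exists>!f. f \<in> (\<Pi>\<^sub>E i\<in>I. N i) \<and> finite {i \<in> I. f i \<noteq> \<zero>\<^bsub>M\<^esub>} \<and>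
       x = finsum M f {i \<in> I. f i \<noteq> \<zero>\<^bsub>M\<^esub>})"

text \<open>The summands may be indexed by themselves: they are nonzero and independent, hence pairwise
  distinct in any such decomposition.\<close>

definition direct_sum_of_indecomposables ::
  "('r, 'k) ring_scheme \<Rightarrow> ('r, 'm, 'p) module_scheme \<Rightarrow> bool"
  where "direct_sum_of_indecomposables R M \<longleftrightarrow>
    (\<exists>\<D>. internal_direct_sum R M \<D> (\<lambda>N. N) \<and> (\<forall>N\<in>\<D>. indecomposable R (M\<lparr>carrier := N\<rparr>)))"

end

theory Submission
  imports Defs
begin

text \<open>Finite presentation makes the union of a chain of \<open>S\<close>-pure submodules \<open>S\<close>-pure. So if \<open>N\<close> is
  \<open>S\<close>-pure and \<open>x \<notin> N\<close>, there is an \<open>S\<close>-pure \<open>L \<supseteq> N\<close> maximal with \<open>x \<notin> L\<close>. Preimages of direct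
  summands of \<open>M/L\<close> are \<open>S\<close>-pure, hence \<open>M/L\<close> is indecomposable by maximality, and the hypothesis
  gives \<open>M = L \<oplus> K\<close> with \<open>K\<close> indecomposable. Then \<open>N \<oplus> K\<close> is again \<open>S\<close>-pure. A second application of
  Zorn's lemma, to independent families consisting of \<open>N\<close> and indecomposable submodules and having an
  \<open>S\<close>-pure sum, therefore produces a family whose sum is \<open>M\<close>: thus \<open>N\<close> is a direct summand, and
  \<open>N = 0\<close> gives the decomposition of \<open>M\<close>.\<close>

section \<open>Submodules of left modules\<close>

text \<open>Neither properness nor being a direct summand passes to unions of chains. So Zorn's
  lemma is run on \<open>S\<close>-pure submodules avoiding one fixed element, and then on families
  with an \<open>S\<close>-pure sum. Sums of pure submodules are not pure in general. Both purity
  claims rest on one fact, \<open>pure_of_complement_mod\<close>: if A + B = M and A \<inter> B is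
  \<open>S\<close>-pure, then so is A, because M/A is isomorphic to B/(A \<inter> B), so a map X ->
  M/A is a map into M/(A \<inter> B) and lifts. With A \<inter> B = L it makes the preimages of
  complementary summands of M/L pure; they cannot both contain x, so maximality makes one of them L.
  With A = N + K and B = L it makes N + K pure, since (N + K) \<inter> L = N by the modular
  law.\<close>

context left_module
begin

lemma smult_r_zero:
  assumes "a \<in> carrier R"
  shows "a \<odot>\<^bsub>M\<^esub> \<zero>\<^bsub>M\<^esub> = \<zero>\<^bsub>M\<^esub>"
proof -
  have "a \<odot>\<^bsub>M\<^esub> \<zero>\<^bsub>M\<^esub> = a \<odot>\<^bsub>M\<^esub> \<zero>\<^bsub>M\<^esub> \<oplus>\<^bsub>M\<^esub> a \<odot>\<^bsub>M\<^esub> \<zero>\<^bsub>M\<^esub>"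
    using smult_r_distr[of a "\<zero>\<^bsub>M\<^esub>" "\<zero>\<^bsub>M\<^esub>"] assms by simp
  then show ?thesis
    using assms by (metis M.add.r_cancel_one' M.zero_closed smult_closed)
qed

lemma smult_l_zero:
  assumes "x \<in> carrier M"
  shows "\<zero> \<odot>\<^bsub>M\<^esub> x = \<zero>\<^bsub>M\<^esub>"
proof -
  have "\<zero> \<odot>\<^bsub>M\<^esub> x = \<zero> \<odot>\<^bsub>M\<^esub> x \<oplus>\<^bsub>M\<^esub> \<zero> \<odot>\<^bsub>M\<^esub> x"
    using smult_l_distr[of \<zero> \<zero> x] assms by simp
  then show ?thesis
    using assms by (metis M.add.r_cancel_one' R.zero_closed smult_closed)
qed

lemma smult_minus_one:
  assumes "x \<in> carrier M"
  shows "(\<ominus> \<one>) \<odot>\<^bsub>M\<^esub> x = \<ominus>\<^bsub>M\<^esub> x"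
proof (rule M.minus_equality[symmetric])
  have "(\<ominus> \<one>) \<odot>\<^bsub>M\<^esub> x \<oplus>\<^bsub>M\<^esub> x = (\<ominus> \<one> \<oplus> \<one>) \<odot>\<^bsub>M\<^esub> x"
    using assms by (simp add: smult_l_distr smult_one)
  then show "(\<ominus> \<one>) \<odot>\<^bsub>M\<^esub> x \<oplus>\<^bsub>M\<^esub> x = \<zero>\<^bsub>M\<^esub>"
    using assms by (simp add: R.l_neg smult_l_zero)
qed (use assms smult_closed in auto)

text \<open>Closure under negation is obtained by scaling with minus one.\<close>

lemma submoduleI:
  assumes "N \<subseteq> carrier M" "\<zero>\<^bsub>M\<^esub> \<in> N"
    and "\<And>x y. \<lbrakk>x \<in> N; y \<in> N\<rbrakk> \<Longrightarrow> x \<oplus>\<^bsub>M\<^esub> y \<in> N"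
    and "\<And>a x. \<lbrakk>a \<in> carrier R; x \<in> N\<rbrakk> \<Longrightarrow> a \<odot>\<^bsub>M\<^esub> x \<in> N"
  shows "submodule N R M"
proof (intro submodule.intro subgroup.intro)
  fix x assume "x \<in> N"
  then have "(\<ominus> \<one>) \<odot>\<^bsub>M\<^esub> x \<in> N" "x \<in> carrier M"
    using assms by auto
  then show "inv\<^bsub>add_monoid M\<^esub> x \<in> N"
    by (metis a_inv_def smult_minus_one)
qed (use assms in \<open>auto simp: submodule_axioms_def\<close>)

lemma
  assumes "submodule N R M"
  shows submodule_subset: "N \<subseteq> carrier M"
    and submodule_zero: "\<zero>\<^bsub>M\<^esub> \<in> N"
    and submodule_add: "\<And>x y. \<lbrakk>x \<in> N; y \<in> N\<rbrakk> \<Longrightarrow> x \<oplus>\<^bsub>M\<^esub> y \<in> N"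
    and submodule_smult: "\<And>a x. \<lbrakk>a \<in> carrier R; x \<in> N\<rbrakk> \<Longrightarrow> a \<odot>\<^bsub>M\<^esub> x \<in> N"
    and submodule_minus: "\<And>x. x \<in> N \<Longrightarrow> \<ominus>\<^bsub>M\<^esub> x \<in> N"
    and submodule_diff: "\<And>x y. \<lbrakk>x \<in> N; y \<in> N\<rbrakk> \<Longrightarrow> x \<ominus>\<^bsub>M\<^esub> y \<in> N"
    and submodule_abelian_subgroup: "abelian_subgroup N M"
proof -
  interpret N: submodule N R M by fact
  show "N \<subseteq> carrier M" "\<zero>\<^bsub>M\<^esub> \<in> N" "\<And>x y. \<lbrakk>x \<in> N; y \<in> N\<rbrakk> \<Longrightarrow> x \<oplus>\<^bsub>M\<^esub> y \<in> N"
    "\<And>a x. \<lbrakk>a \<in> carrier R; x \<in> N\<rbrakk> \<Longrightarrow> a \<odot>\<^bsub>M\<^esub> x \<in> N"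
    using N.subset N.one_closed N.m_closed by auto
  show *: "\<And>x. x \<in> N \<Longrightarrow> \<ominus>\<^bsub>M\<^esub> x \<in> N"
    using N.m_inv_closed by (simp add: a_inv_def)
  show "\<And>x y. \<lbrakk>x \<in> N; y \<in> N\<rbrakk> \<Longrightarrow> x \<ominus>\<^bsub>M\<^esub> y \<in> N"
    using N.m_closed * by (auto simp: a_minus_def)
  show "abelian_subgroup N M"
    by (intro abelian_subgroupI3 additive_subgroupI N.subgroup_axioms M.abelian_group_axioms)
qed

lemma submodule_zero_singleton: "submodule {\<zero>\<^bsub>M\<^esub>} R M"
  by (rule submoduleI) (auto simp: smult_r_zero)

lemma submodule_carrier: "submodule (carrier M) R M"
  by (rule submoduleI) (auto simp: smult_closed)

lemma mem_set_add: "x \<in> A <+>\<^bsub>M\<^esub> B \<longleftrightarrow> (\<exists>a\<in>A. \<exists>b\<in>B. x = a \<oplus>\<^bsub>M\<^esub> b)"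
  by (auto simp: set_add_def')

lemma submodule_set_add:
  assumes "submodule A R M" "submodule B R M"
  shows "submodule (A <+>\<^bsub>M\<^esub> B) R M"
proof (rule submoduleI)
  note A = submodule_subset[OF assms(1)] and B = submodule_subset[OF assms(2)]
  show "A <+>\<^bsub>M\<^esub> B \<subseteq> carrier M"
    using A B by (fastforce simp: mem_set_add)
  show "\<zero>\<^bsub>M\<^esub> \<in> A <+>\<^bsub>M\<^esub> B"
    using submodule_zero assms unfolding mem_set_add by (metis M.l_zero M.zero_closed)
  show "x \<oplus>\<^bsub>M\<^esub> y \<in> A <+>\<^bsub>M\<^esub> B" if "x \<in> A <+>\<^bsub>M\<^esub> B" "y \<in> A <+>\<^bsub>M\<^esub> B" for x y
  proof -
    obtain a b where ab: "a \<in> A" "b \<in> B" "x = a \<oplus>\<^bsub>M\<^esub> b"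
      using \<open>x \<in> A <+>\<^bsub>M\<^esub> B\<close> unfolding mem_set_add by blast
    obtain a' b' where ab': "a' \<in> A" "b' \<in> B" "y = a' \<oplus>\<^bsub>M\<^esub> b'"
      using \<open>y \<in> A <+>\<^bsub>M\<^esub> B\<close> unfolding mem_set_add by blast
    note * = ab ab'
    then have "x \<oplus>\<^bsub>M\<^esub> y = (a \<oplus>\<^bsub>M\<^esub> a') \<oplus>\<^bsub>M\<^esub> (b \<oplus>\<^bsub>M\<^esub> b')"
      using A B by (simp add: M.a_ac subset_iff)
    moreover have "a \<oplus>\<^bsub>M\<^esub> a' \<in> A" "b \<oplus>\<^bsub>M\<^esub> b' \<in> B"
      using * assms submodule_add by auto
    ultimately show ?thesis
      unfolding mem_set_add by blast
  qed
  show "a \<odot>\<^bsub>M\<^esub> x \<in> A <+>\<^bsub>M\<^esub> B" if "a \<in> carrier R" "x \<in> A <+>\<^bsub>M\<^esub> B" for a x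
  proof -
    obtain u v where *: "u \<in> A" "v \<in> B" "x = u \<oplus>\<^bsub>M\<^esub> v"
      using \<open>x \<in> A <+>\<^bsub>M\<^esub> B\<close> unfolding mem_set_add by blast
    then have "a \<odot>\<^bsub>M\<^esub> x = a \<odot>\<^bsub>M\<^esub> u \<oplus>\<^bsub>M\<^esub> a \<odot>\<^bsub>M\<^esub> v"
      using A B that(1) by (simp add: smult_r_distr subset_iff)
    moreover have "a \<odot>\<^bsub>M\<^esub> u \<in> A" "a \<odot>\<^bsub>M\<^esub> v \<in> B"
      using * that assms submodule_smult by auto
    ultimately show ?thesis
      unfolding mem_set_add by blast
  qed
qed

lemma set_add_upper:
  assumes "submodule A R M" "submodule B R M"
  shows "A \<subseteq> A <+>\<^bsub>M\<^esub> B" "B \<subseteq> A <+>\<^bsub>M\<^esub> B"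
proof -
  have "x \<oplus>\<^bsub>M\<^esub> \<zero>\<^bsub>M\<^esub> = x" "\<zero>\<^bsub>M\<^esub> \<oplus>\<^bsub>M\<^esub> x = x" if "x \<in> A \<union> B" for x
    using that submodule_subset[OF assms(1)] submodule_subset[OF assms(2)] by auto
  then show "A \<subseteq> A <+>\<^bsub>M\<^esub> B" "B \<subseteq> A <+>\<^bsub>M\<^esub> B"
    using submodule_zero assms unfolding mem_set_add by (metis UnCI subsetI mem_set_add)+
qed

lemma set_add_least:
  assumes "submodule C R M" "A \<subseteq> C" "B \<subseteq> C"
  shows "A <+>\<^bsub>M\<^esub> B \<subseteq> C"
  using assms(2,3) by (auto simp: mem_set_add intro!: submodule_add[OF assms(1)])

section \<open>Cosets and the operations of the quotient module\<close>

lemma coset_eq_iff: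
  assumes "submodule N R M" "x \<in> carrier M" "y \<in> carrier M"
  shows "N +>\<^bsub>M\<^esub> x = N +>\<^bsub>M\<^esub> y \<longleftrightarrow> x \<ominus>\<^bsub>M\<^esub> y \<in> N"
proof -
  interpret N: abelian_subgroup N M
    using assms submodule_abelian_subgroup by blast
  show ?thesis
    by (metis N.a_rcos_module N.a_repr_independence' N.a_repr_independenceD a_minus_def assms(2,3))
qed

lemma coset_eq_self_iff:
  assumes "submodule N R M" "x \<in> carrier M"
  shows "N +>\<^bsub>M\<^esub> x = N \<longleftrightarrow> x \<in> N"
proof -
  have "N +>\<^bsub>M\<^esub> \<zero>\<^bsub>M\<^esub> = N" "x \<ominus>\<^bsub>M\<^esub> \<zero>\<^bsub>M\<^esub> = x"
    using assms submodule_subset by (auto simp: a_minus_def)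
  then show ?thesis
    by (metis M.zero_closed assms coset_eq_iff)
qed

lemma mem_coset_iff:
  assumes "submodule N R M" "x \<in> carrier M" "y \<in> carrier M"
  shows "y \<in> N +>\<^bsub>M\<^esub> x \<longleftrightarrow> N +>\<^bsub>M\<^esub> x = N +>\<^bsub>M\<^esub> y"
proof -
  interpret N: abelian_subgroup N M
    using assms submodule_abelian_subgroup by blast
  show ?thesis
    using assms N.a_repr_independence' N.a_repr_independenceD by blast
qed

lemma coset_subset:
  assumes "submodule N R M" "x \<in> carrier M"
  shows "N +>\<^bsub>M\<^esub> x \<subseteq> carrier M"
  by (rule M.a_r_coset_subset_G[OF submodule_subset[OF assms(1)] assms(2)])

lemma coset_add_cong:
  assumes "submodule N R M" "x \<in> carrier M" "x' \<in> carrier M" "y \<in> carrier M" "y' \<in> carrier M"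
    and "N +>\<^bsub>M\<^esub> x = N +>\<^bsub>M\<^esub> x'" "N +>\<^bsub>M\<^esub> y = N +>\<^bsub>M\<^esub> y'"
  shows "N +>\<^bsub>M\<^esub> (x \<oplus>\<^bsub>M\<^esub> y) = N +>\<^bsub>M\<^esub> (x' \<oplus>\<^bsub>M\<^esub> y')"
proof -
  interpret N: abelian_subgroup N M
    using assms submodule_abelian_subgroup by blast
  show ?thesis
    by (metis N.a_rcos_sum assms(2-))
qed

text \<open>The difference a x - a x' equals a (x - x') and so stays in \<open>N\<close>; this makes
  scaling of cosets independent of the representative.\<close>

lemma coset_smult_cong:
  assumes "submodule N R M" "a \<in> carrier R" "x \<in> carrier M" "x' \<in> carrier M"
    and "N +>\<^bsub>M\<^esub> x = N +>\<^bsub>M\<^esub> x'"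
  shows "N +>\<^bsub>M\<^esub> (a \<odot>\<^bsub>M\<^esub> x) = N +>\<^bsub>M\<^esub> (a \<odot>\<^bsub>M\<^esub> x')"
proof -
  have "a \<odot>\<^bsub>M\<^esub> (\<ominus>\<^bsub>M\<^esub> x') = \<ominus>\<^bsub>M\<^esub> (a \<odot>\<^bsub>M\<^esub> x')"
    using assms by (metis M.add.inv_closed M.minus_equality M.l_neg smult_closed smult_r_distr smult_r_zero)
  then have "a \<odot>\<^bsub>M\<^esub> x \<ominus>\<^bsub>M\<^esub> a \<odot>\<^bsub>M\<^esub> x' = a \<odot>\<^bsub>M\<^esub> (x \<ominus>\<^bsub>M\<^esub> x')"
    using assms by (simp add: a_minus_def smult_r_distr)
  then show ?thesis
    using assms by (simp add: coset_eq_iff smult_closed submodule_smult)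
qed

text \<open>Used to carry a lift found modulo a small submodule over to a larger one.\<close>

lemma coset_eq_mono:
  assumes "submodule N R M" "submodule L R M" "N \<subseteq> L" "x \<in> carrier M" "y \<in> carrier M"
    and "N +>\<^bsub>M\<^esub> x = N +>\<^bsub>M\<^esub> y"
  shows "L +>\<^bsub>M\<^esub> x = L +>\<^bsub>M\<^esub> y"
  using assms(3,6) coset_eq_iff[OF assms(1,4,5)] coset_eq_iff[OF assms(2,4,5)] by blast

lemma quotient_carrier:
  "carrier (quotient_module M N) = (\<lambda>x. N +>\<^bsub>M\<^esub> x) ` carrier M"
  unfolding quotient_module_def A_RCOSETS_def RCOSETS_def a_r_coset_def by auto

lemma quotient_zero: "\<zero>\<^bsub>quotient_module M N\<^esub> = N"
  by (simp add: quotient_module_def)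

lemma quotient_add:
  assumes "submodule N R M" "x \<in> carrier M" "y \<in> carrier M"
  shows "(N +>\<^bsub>M\<^esub> x) \<oplus>\<^bsub>quotient_module M N\<^esub> (N +>\<^bsub>M\<^esub> y) = N +>\<^bsub>M\<^esub> (x \<oplus>\<^bsub>M\<^esub> y)"
proof -
  interpret N: abelian_subgroup N M
    using assms submodule_abelian_subgroup by blast
  show ?thesis
    using assms by (simp add: quotient_module_def N.a_rcos_sum)
qed

text \<open>The defining union ranges over all representatives of the coset; by
  \<open>coset_smult_cong\<close> it is a nonempty union of copies of one and the same
  coset.\<close>

lemma quotient_smult:
  assumes "submodule N R M" "a \<in> carrier R" "x \<in> carrier M"
  shows "a \<odot>\<^bsub>quotient_module M N\<^esub> (N +>\<^bsub>M\<^esub> x) = N +>\<^bsub>M\<^esub> (a \<odot>\<^bsub>M\<^esub> x)"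
proof -
  have "N +>\<^bsub>M\<^esub> (a \<odot>\<^bsub>M\<^esub> y) = N +>\<^bsub>M\<^esub> (a \<odot>\<^bsub>M\<^esub> x)" if "y \<in> N +>\<^bsub>M\<^esub> x" for y
  proof -
    have y: "y \<in> carrier M"
      using coset_subset[OF assms(1,3)] that by blast
    then have "N +>\<^bsub>M\<^esub> y = N +>\<^bsub>M\<^esub> x"
      using mem_coset_iff[OF assms(1,3)] that by simp
    then show ?thesis
      by (rule coset_smult_cong[OF assms(1,2) y assms(3)])
  qed
  moreover have "x \<in> N +>\<^bsub>M\<^esub> x"
    using assms mem_coset_iff by blast
  ultimately have "(\<Union>y\<in>N +>\<^bsub>M\<^esub> x. N +>\<^bsub>M\<^esub> (a \<odot>\<^bsub>M\<^esub> y)) = N +>\<^bsub>M\<^esub> (a \<odot>\<^bsub>M\<^esub> x)"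
    by blast
  then show ?thesis
    by (simp add: quotient_module_def)
qed

text \<open>Dedekind's modular law. The summand from \<open>K\<close> is recovered as (n + k) - n, a
  difference of elements of \<open>L\<close>. It will be applied with K \<inter> L = 0, where the
  right side collapses to \<open>N\<close>.\<close>

lemma modular_law:
  assumes "submodule N R M" "submodule K R M" "submodule L R M" "N \<subseteq> L"
  shows "(N <+>\<^bsub>M\<^esub> K) \<inter> L = N <+>\<^bsub>M\<^esub> (K \<inter> L)"
proof
  show "(N <+>\<^bsub>M\<^esub> K) \<inter> L \<subseteq> N <+>\<^bsub>M\<^esub> (K \<inter> L)"
  proof
    fix x assume "x \<in> (N <+>\<^bsub>M\<^esub> K) \<inter> L"
    then obtain n k where *: "n \<in> N" "k \<in> K" "x = n \<oplus>\<^bsub>M\<^esub> k" "n \<oplus>\<^bsub>M\<^esub> k \<in> L"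
      by (auto simp: mem_set_add)
    have "n \<in> carrier M" "k \<in> carrier M"
      using * assms submodule_subset by auto
    then have "k = (n \<oplus>\<^bsub>M\<^esub> k) \<ominus>\<^bsub>M\<^esub> n"
      by (simp add: a_minus_def M.a_ac M.r_neg)
    then have "k \<in> L"
      using * assms submodule_diff by (metis subsetD)
    then show "x \<in> N <+>\<^bsub>M\<^esub> (K \<inter> L)"
      using * by (auto simp: mem_set_add)
  qed
  show "N <+>\<^bsub>M\<^esub> (K \<inter> L) \<subseteq> (N <+>\<^bsub>M\<^esub> K) \<inter> L"
  proof
    fix x assume "x \<in> N <+>\<^bsub>M\<^esub> (K \<inter> L)"
    then obtain n k where "n \<in> N" "k \<in> K" "k \<in> L" "x = n \<oplus>\<^bsub>M\<^esub> k"
      unfolding mem_set_add by blast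
    then show "x \<in> (N <+>\<^bsub>M\<^esub> K) \<inter> L"
      using assms(4) submodule_add[OF assms(3)] mem_set_add by blast
  qed
qed

end

section \<open>Purity as lifting of homomorphisms modulo a submodule\<close>

lemma compose_lmod_hom:
  assumes "left_module R X" "f \<in> lmod_hom R A B" "h \<in> lmod_hom R X A"
  shows "compose (carrier X) f h \<in> lmod_hom R X B"
proof -
  interpret X: left_module R X by fact
  show ?thesis
    using assms(2,3) by (fastforce simp: lmod_hom_def compose_def PiE_iff X.smult_closed extensional_def)
qed

lemma compose_in_hom_Hom_group:
  assumes "left_module R X" "f \<in> lmod_hom R A B"
  shows "compose (carrier X) f \<in> hom (Hom_group R X A) (Hom_group R X B)"
proof (rule homI)
  show "compose (carrier X) f h \<in> carrier (Hom_group R X B)" if "h \<in> carrier (Hom_group R X A)" for h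
    using that assms compose_lmod_hom by (fastforce simp: Hom_group_def)
  show "compose (carrier X) f (h \<otimes>\<^bsub>Hom_group R X A\<^esub> k) =
      compose (carrier X) f h \<otimes>\<^bsub>Hom_group R X B\<^esub> compose (carrier X) f k"
    if "h \<in> carrier (Hom_group R X A)" "k \<in> carrier (Hom_group R X A)" for h k
    using that assms(2)
    by (auto simp: Hom_group_def lmod_hom_def compose_def PiE_iff fun_eq_iff)
qed

context left_module
begin

text \<open>Maps to \<open>M\<close> inducing a homomorphism to \<open>M/N\<close>; in these terms purity needs no quotient module.\<close>

definition hom_mod :: "('r, 'x, 'o) module_scheme \<Rightarrow> 'm set \<Rightarrow> ('x \<Rightarrow> 'm) \<Rightarrow> bool"
  where "hom_mod X N g \<longleftrightarrow>
    g \<in> carrier X \<rightarrow> carrier M \<and>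
    (\<forall>x\<in>carrier X. \<forall>y\<in>carrier X. N +>\<^bsub>M\<^esub> g (x \<oplus>\<^bsub>X\<^esub> y) = N +>\<^bsub>M\<^esub> (g x \<oplus>\<^bsub>M\<^esub> g y)) \<and>
    (\<forall>a\<in>carrier R. \<forall>x\<in>carrier X. N +>\<^bsub>M\<^esub> g (a \<odot>\<^bsub>X\<^esub> x) = N +>\<^bsub>M\<^esub> (a \<odot>\<^bsub>M\<^esub> g x))"

text \<open>Surjectivity of Hom(X, M) -> Hom(X, M/N), with maps into M/N replaced by choices of
  representatives.\<close>

definition lifts_mod :: "('r, 'x, 'o) module_scheme \<Rightarrow> 'm set \<Rightarrow> bool"
  where "lifts_mod X N \<longleftrightarrow>
    (\<forall>g. hom_mod X N g \<longrightarrow> (\<exists>h \<in> lmod_hom R X M. \<forall>x\<in>carrier X. N +>\<^bsub>M\<^esub> h x = N +>\<^bsub>M\<^esub> g x))"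

text \<open>Hom is left exact, so surjectivity is the only part of purity left to require.\<close>

definition pure :: "('r, 'x, 'o) module_scheme set \<Rightarrow> 'm set \<Rightarrow> bool"
  where "pure S N \<longleftrightarrow> submodule N R M \<and> (\<forall>X\<in>S. lifts_mod X N)"

lemma proj_lmod_hom:
  assumes "submodule N R M"
  shows "(\<lambda>x\<in>carrier M. N +>\<^bsub>M\<^esub> x) \<in> lmod_hom R M (quotient_module M N)"
  using assms
  by (auto simp: lmod_hom_def quotient_carrier quotient_add quotient_smult smult_closed)

lemma incl_lmod_hom:
  assumes "submodule N R M"
  shows "(\<lambda>x\<in>N. x) \<in> lmod_hom R (M\<lparr>carrier := N\<rparr>) M"
  using assms submodule_subset submodule_add submodule_smult
  by (auto simp: lmod_hom_def PiE_iff)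

text \<open>A homomorphism to M/N and a choice of representatives of its values carry the same
  information: the choice \<open>g\<close> satisfies \<open>hom_mod\<close>, and conversely any such
  \<open>g\<close> induces a homomorphism.\<close>

lemma lifts_mod_iff_surj:
  assumes "left_module R X" "submodule N R M"
  shows "lifts_mod X N \<longleftrightarrow> compose (carrier X) (\<lambda>x\<in>carrier M. N +>\<^bsub>M\<^esub> x) ` lmod_hom R X M =
    lmod_hom R X (quotient_module M N)" (is "_ \<longleftrightarrow> compose _ ?p ` _ = _")
proof -
  interpret X: left_module R X by fact
  have sub: "compose (carrier X) ?p ` lmod_hom R X M \<subseteq> lmod_hom R X (quotient_module M N)"
    using compose_lmod_hom[OF assms(1) proj_lmod_hom[OF assms(2)]] by blast
  show ?thesis
  proof (intro iffI subset_antisym sub)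
    assume L: "lifts_mod X N"
    show "lmod_hom R X (quotient_module M N) \<subseteq> compose (carrier X) ?p ` lmod_hom R X M"
    proof
      fix \<phi> assume \<phi>: "\<phi> \<in> lmod_hom R X (quotient_module M N)"
      then have "\<exists>y\<in>carrier M. \<phi> x = N +>\<^bsub>M\<^esub> y" if "x \<in> carrier X" for x
        using that by (fastforce simp: lmod_hom_def PiE_iff quotient_carrier)
      then obtain g where g: "g x \<in> carrier M" "\<phi> x = N +>\<^bsub>M\<^esub> g x" if "x \<in> carrier X" for x
        by metis
      have "hom_mod X N g"
        unfolding hom_mod_def
      proof (intro conjI ballI)
        fix x y assume *: "x \<in> carrier X" "y \<in> carrier X"
        then have "\<phi> (x \<oplus>\<^bsub>X\<^esub> y) = \<phi> x \<oplus>\<^bsub>quotient_module M N\<^esub> \<phi> y"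
          using \<phi> by (auto simp: lmod_hom_def)
        then show "N +>\<^bsub>M\<^esub> g (x \<oplus>\<^bsub>X\<^esub> y) = N +>\<^bsub>M\<^esub> (g x \<oplus>\<^bsub>M\<^esub> g y)"
          using * g quotient_add[OF assms(2)] by simp
      next
        fix a x assume *: "a \<in> carrier R" "x \<in> carrier X"
        then have "\<phi> (a \<odot>\<^bsub>X\<^esub> x) = a \<odot>\<^bsub>quotient_module M N\<^esub> \<phi> x"
          using \<phi> by (auto simp: lmod_hom_def)
        then show "N +>\<^bsub>M\<^esub> g (a \<odot>\<^bsub>X\<^esub> x) = N +>\<^bsub>M\<^esub> (a \<odot>\<^bsub>M\<^esub> g x)"
          using * g quotient_smult[OF assms(2)] X.smult_closed by simp
      qed (use g in auto)
      then obtain h where h: "h \<in> lmod_hom R X M" "\<forall>x\<in>carrier X. N +>\<^bsub>M\<^esub> h x = N +>\<^bsub>M\<^esub> g x"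
        using L by (auto simp: lifts_mod_def)
      have "compose (carrier X) ?p h = \<phi>"
      proof (rule extensionalityI)
        show "\<phi> \<in> extensional (carrier X)"
          using \<phi> by (auto simp: lmod_hom_def PiE_iff)
        show "compose (carrier X) ?p h x = \<phi> x" if "x \<in> carrier X" for x
          using that g h by (auto simp: compose_def lmod_hom_def PiE_iff)
      qed auto
      then show "\<phi> \<in> compose (carrier X) ?p ` lmod_hom R X M"
        using h by blast
    qed
  next
    assume surj: "compose (carrier X) ?p ` lmod_hom R X M = lmod_hom R X (quotient_module M N)"
    show "lifts_mod X N"
      unfolding lifts_mod_def
    proof (intro allI impI)
      fix g assume g: "hom_mod X N g"
      then have gM: "g x \<in> carrier M" if "x \<in> carrier X" for x
        using that by (auto simp: hom_mod_def)
      define \<phi> where "\<phi> = (\<lambda>x\<in>carrier X. N +>\<^bsub>M\<^esub> g x)"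
      have "\<phi> \<in> lmod_hom R X (quotient_module M N)"
        using g gM quotient_add[OF assms(2)] quotient_smult[OF assms(2)]
        by (auto simp: lmod_hom_def PiE_iff quotient_carrier \<phi>_def hom_mod_def X.smult_closed)
      then obtain h where h: "h \<in> lmod_hom R X M" "compose (carrier X) ?p h = \<phi>"
        using surj by force
      have "N +>\<^bsub>M\<^esub> h x = N +>\<^bsub>M\<^esub> g x" if "x \<in> carrier X" for x
      proof -
        have "h x \<in> carrier M"
          using h that by (auto simp: lmod_hom_def)
        then show ?thesis
          using fun_cong[OF h(2), of x] that by (simp add: compose_def \<phi>_def)
      qed
      then show "\<exists>h \<in> lmod_hom R X M. \<forall>x\<in>carrier X. N +>\<^bsub>M\<^esub> h x = N +>\<^bsub>M\<^esub> g x"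
        using h by blast
    qed
  qed
qed

lemma short_exact_quotient:
  assumes "submodule N R M"
  shows "lmod_short_exact R (M\<lparr>carrier := N\<rparr>) M (quotient_module M N)
    (\<lambda>x\<in>N. x) (\<lambda>x\<in>carrier M. N +>\<^bsub>M\<^esub> x)"
  unfolding lmod_short_exact_def short_exact_def
proof (intro conjI incl_lmod_hom proj_lmod_hom assms)
  show "(\<lambda>x\<in>N. x) \<in> hom (add_monoid (M\<lparr>carrier := N\<rparr>)) (add_monoid M)"
    using incl_lmod_hom[OF assms] by (auto simp: lmod_hom_def hom_def)
  show "(\<lambda>x\<in>carrier M. N +>\<^bsub>M\<^esub> x) \<in> hom (add_monoid M) (add_monoid (quotient_module M N))"
    using proj_lmod_hom[OF assms] by (auto simp: lmod_hom_def hom_def)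
  show "(\<lambda>x\<in>N. x) ` carrier (add_monoid (M\<lparr>carrier := N\<rparr>)) =
      kernel (add_monoid M) (add_monoid (quotient_module M N)) (\<lambda>x\<in>carrier M. N +>\<^bsub>M\<^esub> x)"
    using submodule_subset[OF assms] coset_eq_self_iff[OF assms]
    by (auto simp: kernel_def quotient_zero)
qed (auto simp: quotient_carrier inj_on_def)

lemma lmod_hom_restrict_codomain:
  assumes "submodule N R M" "h \<in> lmod_hom R X M" "h \<in> carrier X \<rightarrow> N"
  shows "h \<in> lmod_hom R X (M\<lparr>carrier := N\<rparr>)"
  using assms by (auto simp: lmod_hom_def PiE_iff)

text \<open>Left exactness of Hom: a map \<open>h\<close> into \<open>M\<close> becomes zero in the
  quotient exactly when all its values lie in \<open>N\<close>, that is, when it comes from the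
  submodule. So only surjectivity at the end of the Hom sequence has content.\<close>

lemma S_pure_submodule_iff_pure:
  assumes "\<And>X. X \<in> S \<Longrightarrow> left_module R X"
  shows "S_pure_submodule R S M N \<longleftrightarrow> pure S N"
proof (cases "submodule N R M")
  case N: True
  let ?i = "\<lambda>x\<in>N. x" and ?p = "\<lambda>x\<in>carrier M. N +>\<^bsub>M\<^esub> x"
  have "short_exact (Hom_group R X (M\<lparr>carrier := N\<rparr>)) (Hom_group R X M)
      (Hom_group R X (quotient_module M N)) (compose (carrier X) ?i) (compose (carrier X) ?p)
    \<longleftrightarrow> lifts_mod X N" if "X \<in> S" for X
  proof -
    note X = assms[OF that]
    \<comment> \<open>Composing with the inclusion changes only the codomain. As homomorphisms are
      extensional, the HOL function stays literally the same, which gives injectivity and identifies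
      the image.\<close>
    have incl: "compose (carrier X) ?i h = h" if "h \<in> lmod_hom R X (M\<lparr>carrier := N\<rparr>)" for h
    proof
      fix x show "compose (carrier X) ?i h x = h x"
        using that by (cases "x \<in> carrier X") (auto simp: compose_def lmod_hom_def PiE_iff extensional_def)
    qed
    have "compose (carrier X) ?i ` lmod_hom R X (M\<lparr>carrier := N\<rparr>) =
      kernel (Hom_group R X M) (Hom_group R X (quotient_module M N)) (compose (carrier X) ?p)"
    proof (intro subset_antisym subsetI)
      fix h assume "h \<in> compose (carrier X) ?i ` lmod_hom R X (M\<lparr>carrier := N\<rparr>)"
      then have h: "h \<in> lmod_hom R X (M\<lparr>carrier := N\<rparr>)"
        using incl by auto
      then have "h \<in> lmod_hom R X M"
        using compose_lmod_hom[OF X incl_lmod_hom[OF N]] incl by metis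
      moreover have "h x \<in> N" if "x \<in> carrier X" for x
        using h that by (auto simp: lmod_hom_def)
      ultimately show "h \<in> kernel (Hom_group R X M) (Hom_group R X (quotient_module M N)) (compose (carrier X) ?p)"
        using submodule_subset[OF N] coset_eq_self_iff[OF N]
        by (auto simp: kernel_def Hom_group_def quotient_zero compose_def fun_eq_iff)
    next
      fix h assume *: "h \<in> kernel (Hom_group R X M) (Hom_group R X (quotient_module M N)) (compose (carrier X) ?p)"
      then have h: "h \<in> lmod_hom R X M"
        and h': "compose (carrier X) ?p h = (\<lambda>x\<in>carrier X. N)"
        by (auto simp: kernel_def Hom_group_def quotient_zero)
      have "h x \<in> N" if "x \<in> carrier X" for x
      proof -
        have "h x \<in> carrier M"
          using h that by (auto simp: lmod_hom_def)
        then show ?thesis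
          using fun_cong[OF h', of x] that coset_eq_self_iff[OF N] by (simp add: compose_def)
      qed
      then have "h \<in> lmod_hom R X (M\<lparr>carrier := N\<rparr>)"
        using lmod_hom_restrict_codomain[OF N h] by blast
      then show "h \<in> compose (carrier X) ?i ` lmod_hom R X (M\<lparr>carrier := N\<rparr>)"
        using incl by force
    qed
    moreover have "inj_on (compose (carrier X) ?i) (lmod_hom R X (M\<lparr>carrier := N\<rparr>))"
      using incl by (auto simp: inj_on_def)
    ultimately show ?thesis
      using compose_in_hom_Hom_group[OF X incl_lmod_hom[OF N]]
        compose_in_hom_Hom_group[OF X proj_lmod_hom[OF N]] lifts_mod_iff_surj[OF X N]
      by (simp add: short_exact_def Hom_group_def)
  qed
  then show ?thesis
    using N short_exact_quotient by (simp add: S_pure_submodule_def S_pure_seq_def pure_def)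
qed (simp add: S_pure_submodule_def pure_def)

text \<open>Modulo zero a coset determines its element, so a homomorphism modulo zero is a
  homomorphism and lifts itself. This starts the family that decomposes \<open>M\<close>.\<close>

lemma pure_zero:
  assumes "\<And>X. X \<in> S \<Longrightarrow> left_module R X"
  shows "pure S {\<zero>\<^bsub>M\<^esub>}"
proof -
  note zero = submodule_zero_singleton
  have "lifts_mod X {\<zero>\<^bsub>M\<^esub>}" if "X \<in> S" for X
    unfolding lifts_mod_def
  proof (intro allI impI)
    interpret X: left_module R X
      using assms that by blast
    fix g assume g: "hom_mod X {\<zero>\<^bsub>M\<^esub>} g"
    have eq: "{\<zero>\<^bsub>M\<^esub>} +>\<^bsub>M\<^esub> x = {\<zero>\<^bsub>M\<^esub>} +>\<^bsub>M\<^esub> y \<longleftrightarrow> x = y" if "x \<in> carrier M" "y \<in> carrier M" for x y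
      using that coset_eq_iff[OF zero] by (metis M.minus_equality M.minus_minus M.add.inv_closed
          M.r_neg a_minus_def singletonD singletonI)
    \<comment> \<open>Restricting makes \<open>g\<close> extensional, as membership in
      \<open>lmod_hom\<close> requires.\<close>
    have "restrict g (carrier X) \<in> lmod_hom R X M"
      using g by (auto simp: lmod_hom_def hom_mod_def Pi_iff eq smult_closed X.smult_closed)
    then show "\<exists>h \<in> lmod_hom R X M. \<forall>x\<in>carrier X. {\<zero>\<^bsub>M\<^esub>} +>\<^bsub>M\<^esub> h x = {\<zero>\<^bsub>M\<^esub>} +>\<^bsub>M\<^esub> g x"
      by (rule bexI[rotated]) simp
  qed
  then show ?thesis
    by (simp add: pure_def zero)
qed

text \<open>Every element of \<open>M\<close> is congruent modulo \<open>A\<close> to one of \<open>B\<close>, and for elements of \<open>B\<close> congruence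
  modulo \<open>A\<close> is congruence modulo \<open>L\<close>, so a homomorphism modulo \<open>A\<close> comes from one modulo \<open>L\<close>.\<close>

lemma pure_of_complement_mod:
  assumes "\<And>X. X \<in> S \<Longrightarrow> left_module R X"
    and "pure S L" "submodule A R M" "submodule B R M"
    and "A <+>\<^bsub>M\<^esub> B = carrier M" "A \<inter> B = L"
  shows "pure S A"
proof -
  note L = assms(2)[unfolded pure_def, THEN conjunct1]
  note A = assms(3) and B = assms(4)
  have cong: "L +>\<^bsub>M\<^esub> x = L +>\<^bsub>M\<^esub> y" if "x \<in> B" "y \<in> B" "A +>\<^bsub>M\<^esub> x = A +>\<^bsub>M\<^esub> y" for x y
  proof -
    have "x \<in> carrier M" "y \<in> carrier M"
      using that submodule_subset[OF B] by auto
    moreover have "x \<ominus>\<^bsub>M\<^esub> y \<in> B"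
      using that submodule_diff[OF B] by blast
    ultimately show ?thesis
      using that(3) assms(6) coset_eq_iff[OF A] coset_eq_iff[OF L] by blast
  qed
  have "lifts_mod X A" if "X \<in> S" for X
    unfolding lifts_mod_def
  proof (intro allI impI)
    interpret X: left_module R X
      using assms(1) that by blast
    fix g assume g: "hom_mod X A g"
    then have gM: "g x \<in> carrier M" if "x \<in> carrier X" for x
      using that by (auto simp: hom_mod_def)
    \<comment> \<open>The \<open>B\<close>-component of \<open>g x\<close> serves as the new
      representative.\<close>
    have "\<exists>b\<in>B. A +>\<^bsub>M\<^esub> b = A +>\<^bsub>M\<^esub> g x" if "x \<in> carrier X" for x
    proof -
      have "g x \<in> A <+>\<^bsub>M\<^esub> B"
        using gM that assms(5) by simp
      then obtain a b where ab: "a \<in> A" "b \<in> B" "g x = a \<oplus>\<^bsub>M\<^esub> b"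
        unfolding mem_set_add by blast
      have M: "a \<in> carrier M" "b \<in> carrier M"
        using ab submodule_subset A B by blast+
      then have "g x \<ominus>\<^bsub>M\<^esub> b = a"
        by (simp add: ab a_minus_def M.a_assoc M.r_neg)
      then have "A +>\<^bsub>M\<^esub> g x = A +>\<^bsub>M\<^esub> b"
        using ab M by (simp add: coset_eq_iff[OF A])
      then show ?thesis
        using ab by metis
    qed
    then obtain b where b: "b x \<in> B" "A +>\<^bsub>M\<^esub> b x = A +>\<^bsub>M\<^esub> g x" if "x \<in> carrier X" for x
      by metis
    have bM: "b x \<in> carrier M" if "x \<in> carrier X" for x
      using b that submodule_subset[OF B] by auto
    \<comment> \<open>Both sides of each congruence lie in the submodule \<open>B\<close>, so it is
      enough to verify it modulo \<open>A\<close> and to sharpen it by \<open>cong\<close>.\<close>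
    have "hom_mod X L b"
      unfolding hom_mod_def
    proof (intro conjI ballI)
      fix x y assume xy: "x \<in> carrier X" "y \<in> carrier X"
      have "A +>\<^bsub>M\<^esub> b (x \<oplus>\<^bsub>X\<^esub> y) = A +>\<^bsub>M\<^esub> (g x \<oplus>\<^bsub>M\<^esub> g y)"
        using xy b(2) g by (simp add: hom_mod_def)
      also have "\<dots> = A +>\<^bsub>M\<^esub> (b x \<oplus>\<^bsub>M\<^esub> b y)"
        using xy b(2) by (intro coset_add_cong A gM bM) auto
      finally show "L +>\<^bsub>M\<^esub> b (x \<oplus>\<^bsub>X\<^esub> y) = L +>\<^bsub>M\<^esub> (b x \<oplus>\<^bsub>M\<^esub> b y)"
        using xy b(1) submodule_add[OF B] by (intro cong) auto
    next
      fix a x assume ax: "a \<in> carrier R" "x \<in> carrier X"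
      then have "A +>\<^bsub>M\<^esub> b (a \<odot>\<^bsub>X\<^esub> x) = A +>\<^bsub>M\<^esub> (a \<odot>\<^bsub>M\<^esub> g x)"
        using b(2) g X.smult_closed by (simp add: hom_mod_def)
      also have "\<dots> = A +>\<^bsub>M\<^esub> (a \<odot>\<^bsub>M\<^esub> b x)"
        using ax b(2) by (intro coset_smult_cong A gM bM) auto
      finally show "L +>\<^bsub>M\<^esub> b (a \<odot>\<^bsub>X\<^esub> x) = L +>\<^bsub>M\<^esub> (a \<odot>\<^bsub>M\<^esub> b x)"
        using ax b(1) submodule_smult[OF B] X.smult_closed by (intro cong) auto
    qed (use bM in auto)
    moreover have "lifts_mod X L"
      using assms(2) \<open>X \<in> S\<close> by (simp add: pure_def)
    ultimately obtain h where h: "h \<in> lmod_hom R X M" "\<forall>x\<in>carrier X. L +>\<^bsub>M\<^esub> h x = L +>\<^bsub>M\<^esub> b x"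
      unfolding lifts_mod_def by blast
    have "A +>\<^bsub>M\<^esub> h x = A +>\<^bsub>M\<^esub> g x" if "x \<in> carrier X" for x
    proof -
      have "h x \<in> carrier M" 
        using h that by (auto simp: lmod_hom_def)
      then have "A +>\<^bsub>M\<^esub> h x = A +>\<^bsub>M\<^esub> b x"
        using coset_eq_mono[OF L A] assms(6) bM h that by blast
      then show ?thesis
        using b that by simp
    qed
    then show "\<exists>h \<in> lmod_hom R X M. \<forall>x\<in>carrier X. A +>\<^bsub>M\<^esub> h x = A +>\<^bsub>M\<^esub> g x"
      using h by blast
  qed
  then show ?thesis
    using A by (simp add: pure_def)
qed

end

section \<open>Finite presentation and unions of chains\<close>

definition unit_vec :: "('r, 'k) ring_scheme \<Rightarrow> nat \<Rightarrow> nat \<Rightarrow> nat \<Rightarrow> 'r"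
  where "unit_vec R n i = (\<lambda>j\<in>{..<n}. if i = j then \<one>\<^bsub>R\<^esub> else \<zero>\<^bsub>R\<^esub>)"

context ring
begin

lemma free_lmodule_carrier: "carrier (free_lmodule R n) = ({..<n} \<rightarrow>\<^sub>E carrier R)"
  by (simp add: free_lmodule_def)

lemma free_lmodule_zero: "\<zero>\<^bsub>free_lmodule R n\<^esub> = (\<lambda>i\<in>{..<n}. \<zero>)"
  by (simp add: free_lmodule_def)

lemma free_lmodule_add: "u \<oplus>\<^bsub>free_lmodule R n\<^esub> v = (\<lambda>i\<in>{..<n}. u i \<oplus> v i)"
  by (simp add: free_lmodule_def)

lemma free_lmodule_smult: "a \<odot>\<^bsub>free_lmodule R n\<^esub> v = (\<lambda>i\<in>{..<n}. a \<otimes> v i)"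
  by (simp add: free_lmodule_def)

lemma free_lmodule_closed:
  "\<zero>\<^bsub>free_lmodule R n\<^esub> \<in> carrier (free_lmodule R n)"
  "unit_vec R n i \<in> carrier (free_lmodule R n)"
  "\<lbrakk>u \<in> carrier (free_lmodule R n); v \<in> carrier (free_lmodule R n)\<rbrakk>
    \<Longrightarrow> u \<oplus>\<^bsub>free_lmodule R n\<^esub> v \<in> carrier (free_lmodule R n)"
  "\<lbrakk>a \<in> carrier R; v \<in> carrier (free_lmodule R n)\<rbrakk>
    \<Longrightarrow> a \<odot>\<^bsub>free_lmodule R n\<^esub> v \<in> carrier (free_lmodule R n)"
  by (auto simp: free_lmodule_def unit_vec_def PiE_iff)

text \<open>Assembles \<open>v\<close> coordinate by coordinate, so that facts compatible with sums
  and scalars need checking only on unit vectors.\<close>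

lemma free_lmodule_induct [consumes 1, case_names zero unit_vec add smult]:
  assumes "v \<in> carrier (free_lmodule R n)"
    and zero: "P \<zero>\<^bsub>free_lmodule R n\<^esub>"
    and unit: "\<And>i. i < n \<Longrightarrow> P (unit_vec R n i)"
    and add: "\<And>u v. \<lbrakk>u \<in> carrier (free_lmodule R n); v \<in> carrier (free_lmodule R n); P u; P v\<rbrakk>
      \<Longrightarrow> P (u \<oplus>\<^bsub>free_lmodule R n\<^esub> v)"
    and smult: "\<And>a v. \<lbrakk>a \<in> carrier R; v \<in> carrier (free_lmodule R n); P v\<rbrakk>
      \<Longrightarrow> P (a \<odot>\<^bsub>free_lmodule R n\<^esub> v)"
  shows "P v"
proof -
  \<comment> \<open>The truncation of \<open>v\<close> to its first \<open>k\<close> coordinates;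
    one more coordinate adds a scalar multiple of a unit vector.\<close>
  define t where "t k = (\<lambda>i\<in>{..<n}. if i < k then v i else \<zero>)" for k
  have v: "v i \<in> carrier R" if "i < n" for i
    using assms(1) that by (auto simp: free_lmodule_carrier)
  have t: "t k \<in> carrier (free_lmodule R n)" for k
    using v by (auto simp: free_lmodule_carrier t_def)
  have "P (t k)" if "k \<le> n" for k
    using that
  proof (induction k)
    case 0
    have "t 0 = \<zero>\<^bsub>free_lmodule R n\<^esub>"
      by (simp add: t_def free_lmodule_zero)
    then show ?case
      using zero by simp
  next
    case (Suc k)
    have "t (Suc k) = t k \<oplus>\<^bsub>free_lmodule R n\<^esub> (v k \<odot>\<^bsub>free_lmodule R n\<^esub> unit_vec R n k)"
      using v Suc.prems
      by (auto simp: t_def free_lmodule_add free_lmodule_smult unit_vec_def fun_eq_iff less_Suc_eq)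
    then show ?case
      using Suc v t by (simp add: add smult unit free_lmodule_closed)
  qed
  moreover have "t n = v"
    using assms(1) by (auto simp: t_def free_lmodule_carrier PiE_iff extensional_def fun_eq_iff)
  ultimately show ?thesis
    by auto
qed

end

context left_module
begin

section \<open>Homomorphisms out of \<open>R^n\<close>\<close>

lemma finsum_smult:
  assumes "finite A" "a \<in> carrier R" "f \<in> A \<rightarrow> carrier M"
  shows "a \<odot>\<^bsub>M\<^esub> finsum M f A = finsum M (\<lambda>i. a \<odot>\<^bsub>M\<^esub> f i) A"
  using assms
proof (induction A rule: finite_induct)
  case empty
  then show ?case
    by (simp add: smult_r_zero)
next
  case (insert i A)
  then show ?case
    by (simp add: Pi_iff smult_closed smult_r_distr)
qed

text \<open>The map out of \<open>R^n\<close> that the universal property of free modules assigns to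
  \<open>b\<close>, kept as a plain function instead of an extensional one.\<close>

definition lin_comb :: "nat \<Rightarrow> (nat \<Rightarrow> 'm) \<Rightarrow> (nat \<Rightarrow> 'r) \<Rightarrow> 'm"
  where "lin_comb n b v = finsum M (\<lambda>i. v i \<odot>\<^bsub>M\<^esub> b i) {..<n}"

lemma
  assumes "b \<in> {..<n} \<rightarrow> carrier M"
  shows lin_comb_closed: "v \<in> carrier (free_lmodule R n) \<Longrightarrow> lin_comb n b v \<in> carrier M"
    and lin_comb_zero: "lin_comb n b \<zero>\<^bsub>free_lmodule R n\<^esub> = \<zero>\<^bsub>M\<^esub>"
    and lin_comb_add: "\<lbrakk>u \<in> carrier (free_lmodule R n); v \<in> carrier (free_lmodule R n)\<rbrakk>
      \<Longrightarrow> lin_comb n b (u \<oplus>\<^bsub>free_lmodule R n\<^esub> v) = lin_comb n b u \<oplus>\<^bsub>M\<^esub> lin_comb n b v"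
    and lin_comb_smult: "\<lbrakk>a \<in> carrier R; v \<in> carrier (free_lmodule R n)\<rbrakk>
      \<Longrightarrow> lin_comb n b (a \<odot>\<^bsub>free_lmodule R n\<^esub> v) = a \<odot>\<^bsub>M\<^esub> lin_comb n b v"
    and lin_comb_unit_vec: "i < n \<Longrightarrow> lin_comb n b (unit_vec R n i) = b i"
proof -
  have b: "b i \<in> carrier M" if "i < n" for i
    using assms that by auto
  show "lin_comb n b v \<in> carrier M" if "v \<in> carrier (free_lmodule R n)"
    using that b unfolding lin_comb_def
    by (intro M.finsum_closed) (auto simp: R.free_lmodule_carrier intro!: smult_closed)
  have "lin_comb n b \<zero>\<^bsub>free_lmodule R n\<^esub> = finsum M (\<lambda>i. \<zero>\<^bsub>M\<^esub>) {..<n}"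
    unfolding lin_comb_def
    by (rule M.finsum_cong') (auto simp: R.free_lmodule_zero smult_l_zero b)
  then show "lin_comb n b \<zero>\<^bsub>free_lmodule R n\<^esub> = \<zero>\<^bsub>M\<^esub>"
    by simp
  show "lin_comb n b (u \<oplus>\<^bsub>free_lmodule R n\<^esub> v) = lin_comb n b u \<oplus>\<^bsub>M\<^esub> lin_comb n b v"
    if "u \<in> carrier (free_lmodule R n)" "v \<in> carrier (free_lmodule R n)"
  proof -
    have *: "u i \<in> carrier R" "v i \<in> carrier R" if "i < n" for i
      using that \<open>u \<in> _\<close> \<open>v \<in> _\<close> by (auto simp: R.free_lmodule_carrier)
    have "lin_comb n b (u \<oplus>\<^bsub>free_lmodule R n\<^esub> v) =
        finsum M (\<lambda>i. u i \<odot>\<^bsub>M\<^esub> b i \<oplus>\<^bsub>M\<^esub> v i \<odot>\<^bsub>M\<^esub> b i) {..<n}"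
      unfolding lin_comb_def
      by (rule M.finsum_cong') (auto simp: R.free_lmodule_add smult_l_distr smult_closed b *)
    also have "\<dots> = lin_comb n b u \<oplus>\<^bsub>M\<^esub> lin_comb n b v"
      unfolding lin_comb_def by (rule M.finsum_addf) (auto simp: smult_closed b *)
    finally show ?thesis .
  qed
  show "lin_comb n b (a \<odot>\<^bsub>free_lmodule R n\<^esub> v) = a \<odot>\<^bsub>M\<^esub> lin_comb n b v"
    if "a \<in> carrier R" "v \<in> carrier (free_lmodule R n)"
  proof -
    have *: "v i \<in> carrier R" if "i < n" for i
      using that \<open>v \<in> _\<close> by (auto simp: R.free_lmodule_carrier)
    have "lin_comb n b (a \<odot>\<^bsub>free_lmodule R n\<^esub> v) = finsum M (\<lambda>i. a \<odot>\<^bsub>M\<^esub> (v i \<odot>\<^bsub>M\<^esub> b i)) {..<n}"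
      unfolding lin_comb_def using that(1)
      by (intro M.finsum_cong') (auto simp: R.free_lmodule_smult smult_assoc smult_closed b *)
    also have "\<dots> = a \<odot>\<^bsub>M\<^esub> lin_comb n b v"
      unfolding lin_comb_def using that(1)
      by (intro finsum_smult[symmetric]) (auto simp: smult_closed b *)
    finally show ?thesis .
  qed
  show "lin_comb n b (unit_vec R n i) = b i" if "i < n"
  proof -
    have "lin_comb n b (unit_vec R n i) = finsum M (\<lambda>j. if i = j then b j else \<zero>\<^bsub>M\<^esub>) {..<n}"
      unfolding lin_comb_def
      by (rule M.finsum_cong') (auto simp: unit_vec_def smult_l_zero smult_one b)
    also have "\<dots> = b i"
      using that b by (intro M.finsum_singleton) auto
    finally show ?thesis .
  qed
qed

text \<open>Writing 0 as 0 times 0, the value g(0) is congruent to 0 g(0) = 0. The conditions on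
  \<open>X\<close> are stated so as to cover \<open>free_lmodule R n\<close> as well, for which no
  \<open>left_module\<close> instance is established.\<close>

lemma hom_mod_zero:
  assumes "submodule N R M" "hom_mod X N g" "\<zero>\<^bsub>X\<^esub> \<in> carrier X" "\<zero> \<odot>\<^bsub>X\<^esub> \<zero>\<^bsub>X\<^esub> = \<zero>\<^bsub>X\<^esub>"
  shows "N +>\<^bsub>M\<^esub> g \<zero>\<^bsub>X\<^esub> = N"
proof -
  have g: "g \<zero>\<^bsub>X\<^esub> \<in> carrier M"
    using assms by (auto simp: hom_mod_def)
  have "N +>\<^bsub>M\<^esub> g \<zero>\<^bsub>X\<^esub> = N +>\<^bsub>M\<^esub> (\<zero> \<odot>\<^bsub>M\<^esub> g \<zero>\<^bsub>X\<^esub>)"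
    using assms unfolding hom_mod_def by (metis R.zero_closed)
  also have "\<dots> = N"
    using g coset_eq_self_iff[OF assms(1)] submodule_zero[OF assms(1)] by (simp add: smult_l_zero)
  finally show ?thesis .
qed

text \<open>Free modules are projective: both sides respect sums and scalars modulo \<open>N\<close>
  and agree on unit vectors, so the choice of representatives \<open>G\<close> can be replaced by a
  true homomorphism.\<close>

lemma hom_mod_free_eq_lin_comb:
  assumes "submodule N R M" "hom_mod (free_lmodule R n) N G" "v \<in> carrier (free_lmodule R n)"
  shows "N +>\<^bsub>M\<^esub> G v = N +>\<^bsub>M\<^esub> lin_comb n (\<lambda>i. G (unit_vec R n i)) v"
proof -
  let ?b = "\<lambda>i. G (unit_vec R n i)"
  have G: "G v \<in> carrier M" if "v \<in> carrier (free_lmodule R n)" for v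
    using assms(2) that by (auto simp: hom_mod_def)
  then have b: "?b \<in> {..<n} \<rightarrow> carrier M"
    using R.free_lmodule_closed by auto
  show ?thesis
    using assms(3)
  proof (induction rule: R.free_lmodule_induct)
    case zero
    have "\<zero> \<odot>\<^bsub>free_lmodule R n\<^esub> \<zero>\<^bsub>free_lmodule R n\<^esub> = \<zero>\<^bsub>free_lmodule R n\<^esub>"
      by (auto simp: R.free_lmodule_smult R.free_lmodule_zero fun_eq_iff)
    then have "N +>\<^bsub>M\<^esub> G \<zero>\<^bsub>free_lmodule R n\<^esub> = N"
      by (rule hom_mod_zero[OF assms(1,2) R.free_lmodule_closed(1)])
    then show ?case
      using coset_eq_self_iff[OF assms(1), of "\<zero>\<^bsub>M\<^esub>"] submodule_zero[OF assms(1)]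
      by (simp add: lin_comb_zero[OF b])
  next
    case (unit_vec i)
    then show ?case
      by (simp add: lin_comb_unit_vec[OF b])
  next
    case (add u v)
    have "N +>\<^bsub>M\<^esub> G (u \<oplus>\<^bsub>free_lmodule R n\<^esub> v) = N +>\<^bsub>M\<^esub> (G u \<oplus>\<^bsub>M\<^esub> G v)"
      using assms(2) add by (auto simp: hom_mod_def)
    also have "\<dots> = N +>\<^bsub>M\<^esub> (lin_comb n ?b u \<oplus>\<^bsub>M\<^esub> lin_comb n ?b v)"
      using add by (intro coset_add_cong assms(1) G lin_comb_closed[OF b]) auto
    finally show ?case
      using add by (simp add: lin_comb_add[OF b])
  next
    case (smult a v)
    have "N +>\<^bsub>M\<^esub> G (a \<odot>\<^bsub>free_lmodule R n\<^esub> v) = N +>\<^bsub>M\<^esub> (a \<odot>\<^bsub>M\<^esub> G v)"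
      using assms(2) smult by (auto simp: hom_mod_def)
    also have "\<dots> = N +>\<^bsub>M\<^esub> (a \<odot>\<^bsub>M\<^esub> lin_comb n ?b v)"
      using smult by (intro coset_smult_cong assms(1) G lin_comb_closed[OF b]) auto
    finally show ?case
      using smult by (simp add: lin_comb_smult[OF b])
  qed
qed

text \<open>The relations of a finite presentation of \<open>X\<close> are finitely many, so a homomorphism modulo
  the union of a chain agrees with one modulo a member of the chain.\<close>

lemma hom_mod_Union_chain:
  assumes X: "left_module R X" "finitely_presented R X"
    and C: "C \<noteq> {}" "subset.chain {K. submodule K R M} C"
    and N: "submodule (\<Union>C) R M" and g: "hom_mod X (\<Union>C) g"
  obtains K g' where "K \<in> C" "hom_mod X K g'" "\<And>x. x \<in> carrier X \<Longrightarrow> \<Union>C +>\<^bsub>M\<^esub> g' x = \<Union>C +>\<^bsub>M\<^esub> g x"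
proof -
  interpret X: left_module R X by fact
  obtain m n f p where f: "f \<in> lmod_hom R (free_lmodule R m) (free_lmodule R n)"
    and p: "p \<in> lmod_hom R (free_lmodule R n) X"
    and ker: "f ` carrier (free_lmodule R m) = a_kernel (free_lmodule R n) X p"
    and surj: "p ` carrier (free_lmodule R n) = carrier X"
    using X(2) by (auto simp: finitely_presented_def)
  have pX: "p v \<in> carrier X" if "v \<in> carrier (free_lmodule R n)" for v
    using that surj by blast
  have p_add: "p (u \<oplus>\<^bsub>free_lmodule R n\<^esub> v) = p u \<oplus>\<^bsub>X\<^esub> p v"
    if "u \<in> carrier (free_lmodule R n)" "v \<in> carrier (free_lmodule R n)" for u v
    using that p by (auto simp: lmod_hom_def)
  have p_smult: "p (a \<odot>\<^bsub>free_lmodule R n\<^esub> v) = a \<odot>\<^bsub>X\<^esub> p v"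
    if "a \<in> carrier R" "v \<in> carrier (free_lmodule R n)" for a v
    using that p by (auto simp: lmod_hom_def)
  have G: "hom_mod (free_lmodule R n) (\<Union>C) (\<lambda>v. g (p v))"
    using g pX p_add p_smult by (auto simp: hom_mod_def Pi_iff)
  \<comment> \<open>The images of the generators of \<open>X\<close>. The map \<open>?L\<close> is
    an honest homomorphism from \<open>R^n\<close> to \<open>M\<close> that agrees with
    \<open>g\<close> after \<open>p\<close> modulo the union; it will be made to descend to
    \<open>X\<close> modulo a single member.\<close>
  define b where "b i = g (p (unit_vec R n i))" for i
  let ?L = "lin_comb n b"
  have b: "b \<in> {..<n} \<rightarrow> carrier M"
    using g pX R.free_lmodule_closed by (auto simp: b_def hom_mod_def)
  have gL: "\<Union>C +>\<^bsub>M\<^esub> g (p v) = \<Union>C +>\<^bsub>M\<^esub> ?L v" if "v \<in> carrier (free_lmodule R n)" for v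
    using hom_mod_free_eq_lin_comb[OF N G that] by (simp add: b_def[abs_def])
  have g0: "\<Union>C +>\<^bsub>M\<^esub> g \<zero>\<^bsub>X\<^esub> = \<Union>C"
    by (rule hom_mod_zero[OF N g]) (auto simp: X.smult_l_zero)
  have f_ker: "f c \<in> carrier (free_lmodule R n)" "p (f c) = \<zero>\<^bsub>X\<^esub>"
    if "c \<in> carrier (free_lmodule R m)" for c
    using that ker by (auto simp: a_kernel_def' set_eq_iff)
  \<comment> \<open>A generating relation is zero in \<open>X\<close>, so \<open>?L\<close> sends it
    to zero modulo the union.\<close>
  have "?L (f (unit_vec R m j)) \<in> \<Union>C" for j
    using gL[of "f (unit_vec R m j)"] f_ker[OF R.free_lmodule_closed(2)[of m j]] g0
      coset_eq_self_iff[OF N] lin_comb_closed[OF b] by metis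
  then have "(\<lambda>j. ?L (f (unit_vec R m j))) ` {..<m} \<subseteq> \<Union>C"
    by blast
  \<comment> \<open>Finite presentation enters here: there are only \<open>m\<close> generating
    relations, and finitely many elements of the union of a chain lie in one member.\<close>
  then obtain K where K: "K \<in> C" "(\<lambda>j. ?L (f (unit_vec R m j))) ` {..<m} \<subseteq> K"
    using finite_subset_Union_chain[OF _ _ C] by (metis finite_imageI finite_lessThan)
  then have Ksub: "submodule K R M"
    using C(2) by (auto simp: subset_chain_def)
  have "?L (f c) \<in> K" if "c \<in> carrier (free_lmodule R m)" for c
    using that
  proof (induction rule: R.free_lmodule_induct)
    case zero
    let ?z = "\<zero>\<^bsub>free_lmodule R m\<^esub>"
    have z: "?z \<in> carrier (free_lmodule R m)"
      by (rule R.free_lmodule_closed)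
    \<comment> \<open>Zero is the scalar zero times itself, so compatibility with scalars alone
      yields the value at zero.\<close>
    have "?z = \<zero> \<odot>\<^bsub>free_lmodule R m\<^esub> ?z"
      by (auto simp: R.free_lmodule_smult R.free_lmodule_zero fun_eq_iff)
    then have "f ?z = \<zero> \<odot>\<^bsub>free_lmodule R n\<^esub> f ?z"
      using f z unfolding lmod_hom_def by (metis (mono_tags, lifting) R.zero_closed mem_Collect_eq)
    then have "?L (f ?z) = \<zero> \<odot>\<^bsub>M\<^esub> ?L (f ?z)"
      using lin_comb_smult[OF b R.zero_closed f_ker(1)[OF z]] by simp
    then show ?case
      using lin_comb_closed[OF b f_ker(1)[OF z]] submodule_zero[OF Ksub] by (simp add: smult_l_zero)
  next
    case (unit_vec i)
    then show ?case
      using K by auto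
  next
    case (add u v)
    then have "f (u \<oplus>\<^bsub>free_lmodule R m\<^esub> v) = f u \<oplus>\<^bsub>free_lmodule R n\<^esub> f v"
      using f by (auto simp: lmod_hom_def)
    then show ?case
      using add f_ker submodule_add[OF Ksub] by (simp add: lin_comb_add[OF b])
  next
    case (smult a v)
    then have "f (a \<odot>\<^bsub>free_lmodule R m\<^esub> v) = a \<odot>\<^bsub>free_lmodule R n\<^esub> f v"
      using f by (auto simp: lmod_hom_def)
    then show ?case
      using smult f_ker submodule_smult[OF Ksub] by (simp add: lin_comb_smult[OF b])
  qed
  then have kerK: "?L w \<in> K" if "w \<in> carrier (free_lmodule R n)" "p w = \<zero>\<^bsub>X\<^esub>" for w
  proof -
    have "w \<in> f ` carrier (free_lmodule R m)"
      using that ker by (simp add: a_kernel_def')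
    then show ?thesis
      using \<open>\<And>c. c \<in> carrier (free_lmodule R m) \<Longrightarrow> ?L (f c) \<in> K\<close> by blast
  qed
  \<comment> \<open>\<open>?L\<close> sends all relations into \<open>K\<close>, so modulo
    \<open>K\<close> its value depends only on the image in \<open>X\<close>; thus it descends to
    \<open>X\<close>.\<close>
  have well: "K +>\<^bsub>M\<^esub> ?L u = K +>\<^bsub>M\<^esub> ?L v"
    if uv: "u \<in> carrier (free_lmodule R n)" "v \<in> carrier (free_lmodule R n)" "p u = p v" for u v
  proof -
    \<comment> \<open>This is u - v, written with the scalar minus one so that linearity of
      \<open>p\<close> and \<open>?L\<close> applies directly.\<close>
    let ?w = "u \<oplus>\<^bsub>free_lmodule R n\<^esub> (\<ominus> \<one>) \<odot>\<^bsub>free_lmodule R n\<^esub> v"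
    have w: "(\<ominus> \<one>) \<odot>\<^bsub>free_lmodule R n\<^esub> v \<in> carrier (free_lmodule R n)"
      using uv by (intro R.free_lmodule_closed) auto
    have "p ?w = \<zero>\<^bsub>X\<^esub>"
      using uv w pX by (simp add: p_add p_smult X.smult_minus_one X.M.r_neg)
    then have "?L ?w \<in> K"
      using uv w by (intro kerK R.free_lmodule_closed) auto
    then show ?thesis
      using uv w lin_comb_closed[OF b]
      by (simp add: lin_comb_add[OF b] lin_comb_smult[OF b] smult_minus_one coset_eq_iff[OF Ksub] a_minus_def)
  qed
  have "\<exists>v. v \<in> carrier (free_lmodule R n) \<and> p v = x" if "x \<in> carrier X" for x
    using that unfolding surj[symmetric] by fast
  \<comment> \<open>A section of \<open>p\<close>, merely as a function. The map sought is
    \<open>?L\<close> after \<open>s\<close>; by \<open>well\<close> the choice does not matter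
    modulo \<open>K\<close>.\<close>
  then obtain s where s: "s x \<in> carrier (free_lmodule R n)" "p (s x) = x" if "x \<in> carrier X" for x
    by metis
  show thesis
  proof
    show "hom_mod X K (\<lambda>x. ?L (s x))"
      unfolding hom_mod_def
    proof (intro conjI ballI)
      fix x y assume xy: "x \<in> carrier X" "y \<in> carrier X"
      then have "K +>\<^bsub>M\<^esub> ?L (s (x \<oplus>\<^bsub>X\<^esub> y)) = K +>\<^bsub>M\<^esub> ?L (s x \<oplus>\<^bsub>free_lmodule R n\<^esub> s y)"
        using s by (intro well R.free_lmodule_closed) (auto simp: p_add)
      also have "?L (s x \<oplus>\<^bsub>free_lmodule R n\<^esub> s y) = ?L (s x) \<oplus>\<^bsub>M\<^esub> ?L (s y)"
        using xy s by (intro lin_comb_add[OF b]) auto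
      finally show "K +>\<^bsub>M\<^esub> ?L (s (x \<oplus>\<^bsub>X\<^esub> y)) = K +>\<^bsub>M\<^esub> (?L (s x) \<oplus>\<^bsub>M\<^esub> ?L (s y))" .
    next
      fix a x assume ax: "a \<in> carrier R" "x \<in> carrier X"
      then have "K +>\<^bsub>M\<^esub> ?L (s (a \<odot>\<^bsub>X\<^esub> x)) = K +>\<^bsub>M\<^esub> ?L (a \<odot>\<^bsub>free_lmodule R n\<^esub> s x)"
        using s X.smult_closed by (intro well R.free_lmodule_closed) (auto simp: p_smult)
      also have "?L (a \<odot>\<^bsub>free_lmodule R n\<^esub> s x) = a \<odot>\<^bsub>M\<^esub> ?L (s x)"
        using ax s by (intro lin_comb_smult[OF b]) auto
      finally show "K +>\<^bsub>M\<^esub> ?L (s (a \<odot>\<^bsub>X\<^esub> x)) = K +>\<^bsub>M\<^esub> (a \<odot>\<^bsub>M\<^esub> ?L (s x))" .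
    qed (use s lin_comb_closed[OF b] in auto)
    show "\<Union>C +>\<^bsub>M\<^esub> ?L (s x) = \<Union>C +>\<^bsub>M\<^esub> g x" if "x \<in> carrier X" for x
      using that s gL[of "s x"] by simp
  qed (rule K)
qed

section \<open>Unions of chains of submodules\<close>

lemma submodule_Union_chain:
  assumes "C \<noteq> {}" "subset.chain {K. submodule K R M} C"
  shows "submodule (\<Union>C) R M"
proof (rule submoduleI)
  have sub: "submodule K R M" if "K \<in> C" for K
    using assms(2) that by (auto simp: subset_chain_def)
  show "\<Union>C \<subseteq> carrier M"
    using submodule_subset[OF sub] by blast
  show "\<zero>\<^bsub>M\<^esub> \<in> \<Union>C"
    using assms(1) submodule_zero[OF sub] by blast
  show "x \<oplus>\<^bsub>M\<^esub> y \<in> \<Union>C" if "x \<in> \<Union>C" "y \<in> \<Union>C" for x y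
  proof -
    obtain K L where "K \<in> C" "L \<in> C" "x \<in> K" "y \<in> L"
      using \<open>x \<in> \<Union>C\<close> \<open>y \<in> \<Union>C\<close> by blast
    moreover from this have "K \<subseteq> L \<or> L \<subseteq> K"
      using assms(2) by (simp add: subset_chain_def)
    ultimately obtain K where "K \<in> C" "x \<in> K" "y \<in> K"
      by blast
    then show ?thesis
      using submodule_add[OF sub] by blast
  qed
  show "a \<odot>\<^bsub>M\<^esub> x \<in> \<Union>C" if "a \<in> carrier R" "x \<in> \<Union>C" for a x
    using that submodule_smult[OF sub] by blast
qed

text \<open>The lifting problem over the union is moved down to a member \<open>K\<close> of the
  chain and solved there because \<open>K\<close> is pure; the solution is then read modulo the
  union again.\<close>

lemma pure_Union_chain:
  assumes "\<And>X. X \<in> S \<Longrightarrow> left_module R X" "\<And>X. X \<in> S \<Longrightarrow> finitely_presented R X"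
    and "C \<noteq> {}" "subset.chain {K. pure S K} C"
  shows "pure S (\<Union>C)"
proof -
  have C: "subset.chain {K. submodule K R M} C"
    using assms(4) by (auto simp: subset_chain_def pure_def)
  note N = submodule_Union_chain[OF assms(3) C]
  have "lifts_mod X (\<Union>C)" if "X \<in> S" for X
    unfolding lifts_mod_def
  proof (intro allI impI)
    fix g assume "hom_mod X (\<Union>C) g"
    then obtain K g' where K: "K \<in> C" "hom_mod X K g'"
      and g': "\<And>x. x \<in> carrier X \<Longrightarrow> \<Union>C +>\<^bsub>M\<^esub> g' x = \<Union>C +>\<^bsub>M\<^esub> g x"
      using hom_mod_Union_chain[OF assms(1,2)[OF \<open>X \<in> S\<close>] assms(3) C N] by metis
    have "pure S K"
      using K(1) assms(4) by (auto simp: subset_chain_def)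
    then have sub: "submodule K R M" and "lifts_mod X K"
      using \<open>X \<in> S\<close> by (auto simp: pure_def)
    then obtain h where h: "h \<in> lmod_hom R X M" "\<forall>x\<in>carrier X. K +>\<^bsub>M\<^esub> h x = K +>\<^bsub>M\<^esub> g' x"
      using K(2) unfolding lifts_mod_def by blast
    have "\<Union>C +>\<^bsub>M\<^esub> h x = \<Union>C +>\<^bsub>M\<^esub> g x" if "x \<in> carrier X" for x
    proof -
      have "h x \<in> carrier M" "g' x \<in> carrier M"
        using h K(2) that by (auto simp: lmod_hom_def hom_mod_def)
      then have "\<Union>C +>\<^bsub>M\<^esub> h x = \<Union>C +>\<^bsub>M\<^esub> g' x"
        using coset_eq_mono[OF sub N] K(1) h(2) that by blast
      then show ?thesis
        using g' that by simp
    qed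
    then show "\<exists>h \<in> lmod_hom R X M. \<forall>x\<in>carrier X. \<Union>C +>\<^bsub>M\<^esub> h x = \<Union>C +>\<^bsub>M\<^esub> g x"
      using h(1) by blast
  qed
  then show ?thesis
    using N by (simp add: pure_def)
qed

section \<open>Indecomposable complements\<close>

lemma set_add_commute:
  assumes "A \<subseteq> carrier M" "B \<subseteq> carrier M"
  shows "A <+>\<^bsub>M\<^esub> B = B <+>\<^bsub>M\<^esub> A"
proof -
  have *: "U <+>\<^bsub>M\<^esub> V \<subseteq> V <+>\<^bsub>M\<^esub> U" if "U \<subseteq> carrier M" "V \<subseteq> carrier M" for U V
  proof
    fix x assume "x \<in> U <+>\<^bsub>M\<^esub> V"
    then obtain u v where "u \<in> U" "v \<in> V" "x = u \<oplus>\<^bsub>M\<^esub> v"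
      unfolding mem_set_add by blast
    moreover from this have "u \<oplus>\<^bsub>M\<^esub> v = v \<oplus>\<^bsub>M\<^esub> u"
      using that M.a_comm by blast
    ultimately show "x \<in> V <+>\<^bsub>M\<^esub> U"
      unfolding mem_set_add by metis
  qed
  show ?thesis
    using * assms by blast
qed

text \<open>Avoiding one fixed element passes to unions of chains, whereas being proper need
  not.\<close>

lemma exists_maximal_pure:
  assumes "\<And>X. X \<in> S \<Longrightarrow> left_module R X" "\<And>X. X \<in> S \<Longrightarrow> finitely_presented R X"
    and "pure S N" "x \<notin> N"
  obtains L where "pure S L" "N \<subseteq> L" "x \<notin> L" "\<And>A. \<lbrakk>pure S A; L \<subseteq> A; x \<notin> A\<rbrakk> \<Longrightarrow> A = L"
proof -
  let ?Z = "{L. pure S L \<and> N \<subseteq> L \<and> x \<notin> L}"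
  have "\<exists>L\<in>?Z. \<forall>A\<in>?Z. L \<subseteq> A \<longrightarrow> A = L"
  proof (rule subset_Zorn_nonempty)
    show "?Z \<noteq> {}"
      using assms(3,4) by blast
    fix C assume C: "C \<noteq> {}" "subset.chain ?Z C"
    then have "subset.chain {K. pure S K} C"
      by (auto simp: subset_chain_def)
    then have "pure S (\<Union>C)"
      using pure_Union_chain[OF assms(1,2) C(1)] by blast
    then show "\<Union>C \<in> ?Z"
      using C by (auto simp: subset_chain_def)
  qed
  then obtain L where "L \<in> ?Z" "\<forall>A\<in>?Z. L \<subseteq> A \<longrightarrow> A = L"
    by blast
  then show thesis
    using that[of L] by blast
qed

text \<open>If M/L = A/L \<oplus> B/L, then \<open>A\<close> and \<open>B\<close> are both pure.
  Their intersection \<open>L\<close> misses \<open>x\<close>, so one of them misses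
  \<open>x\<close> too and equals \<open>L\<close> by maximality.\<close>

lemma maximal_pure_irreducible:
  assumes "\<And>X. X \<in> S \<Longrightarrow> left_module R X"
    and "pure S L" "x \<notin> L" "\<And>A. \<lbrakk>pure S A; L \<subseteq> A; x \<notin> A\<rbrakk> \<Longrightarrow> A = L"
    and "submodule A R M" "submodule B R M" "A <+>\<^bsub>M\<^esub> B = carrier M" "A \<inter> B = L"
  shows "A = L \<or> B = L"
proof -
  have "B <+>\<^bsub>M\<^esub> A = carrier M"
    using assms(5-7) set_add_commute submodule_subset by metis
  then have "pure S A" "pure S B"
    using pure_of_complement_mod[of S L A B] pure_of_complement_mod[of S L B A] assms by auto
  moreover have "x \<notin> A \<or> x \<notin> B"
    using assms(3,8) by blast
  ultimately show ?thesis
    using assms(4,8) by blast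
qed

text \<open>Decompositions of the quotient pull back along the projection to pairs as in
  \<open>irred\<close>. The zero of the quotient is the coset \<open>L\<close> itself, so a zero
  summand appears as \<open>{L}\<close>.\<close>

lemma indecomposable_quotient:
  assumes L: "submodule L R M" "L \<noteq> carrier M"
    and irred: "\<And>A B. \<lbrakk>submodule A R M; submodule B R M; A <+>\<^bsub>M\<^esub> B = carrier M; A \<inter> B = L\<rbrakk>
      \<Longrightarrow> A = L \<or> B = L"
  shows "indecomposable R (quotient_module M L)"
  unfolding indecomposable_def quotient_zero
proof (intro conjI allI impI)
  let ?Q = "quotient_module M L"
  show "carrier ?Q \<noteq> {L}"
  proof
    assume "carrier ?Q = {L}"
    then have "carrier M \<subseteq> L"
      using coset_eq_self_iff[OF L(1)] unfolding quotient_carrier by blast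
    then show False
      using L submodule_subset by blast
  qed
  fix P K assume PK: "complementary R ?Q P K"
  define pre where "pre T = {x \<in> carrier M. L +>\<^bsub>M\<^esub> x \<in> T}" for T
  have sub: "T \<subseteq> carrier ?Q" "L \<in> T" "submodule (pre T) R M" if "submodule T R ?Q" for T
  proof -
    interpret T: submodule T R ?Q by fact
    show "T \<subseteq> carrier ?Q"
      using T.subset by simp
    show LT: "L \<in> T"
      using T.one_closed by (simp add: quotient_zero)
    show "submodule (pre T) R M"
    proof (rule submoduleI)
      show "\<zero>\<^bsub>M\<^esub> \<in> pre T"
        using LT coset_eq_self_iff[OF L(1), of "\<zero>\<^bsub>M\<^esub>"] submodule_zero[OF L(1)] by (simp add: pre_def)
      show "x \<oplus>\<^bsub>M\<^esub> y \<in> pre T" if "x \<in> pre T" "y \<in> pre T" for x y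
        using that T.m_closed[of "L +>\<^bsub>M\<^esub> x" "L +>\<^bsub>M\<^esub> y"] by (simp add: pre_def quotient_add[OF L(1)])
      show "a \<odot>\<^bsub>M\<^esub> x \<in> pre T" if "a \<in> carrier R" "x \<in> pre T" for a x
        using that T.smult_closed[of a "L +>\<^bsub>M\<^esub> x"]
        by (simp add: pre_def quotient_smult[OF L(1)] smult_closed)
    qed (auto simp: pre_def)
  qed
  have P: "submodule P R ?Q" and K: "submodule K R ?Q"
    and sum: "P <+>\<^bsub>?Q\<^esub> K = carrier ?Q" and int: "P \<inter> K = {L}"
    using PK by (auto simp: complementary_def quotient_zero)
  have "carrier M \<subseteq> pre P <+>\<^bsub>M\<^esub> pre K"
  proof
    fix x assume x: "x \<in> carrier M"
    then have "L +>\<^bsub>M\<^esub> x \<in> P <+>\<^bsub>?Q\<^esub> K"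
      using sum by (simp add: quotient_carrier)
    then obtain p k where pk: "p \<in> P" "k \<in> K" "L +>\<^bsub>M\<^esub> x = p \<oplus>\<^bsub>?Q\<^esub> k"
      by (auto simp: set_add_def')
    moreover obtain a where "a \<in> carrier M" "p = L +>\<^bsub>M\<^esub> a"
      using pk(1) sub(1)[OF P] unfolding quotient_carrier by blast
    moreover obtain b where "b \<in> carrier M" "k = L +>\<^bsub>M\<^esub> b"
      using pk(2) sub(1)[OF K] unfolding quotient_carrier by blast
    moreover note ab = calculation(4-)
    ultimately have "L +>\<^bsub>M\<^esub> x = L +>\<^bsub>M\<^esub> (a \<oplus>\<^bsub>M\<^esub> b)"
      using quotient_add[OF L(1)] by simp
    \<comment> \<open>Modulo \<open>L\<close>, x - b is congruent to a; hence x = (x - b) + b splits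
      x along the two preimages.\<close>
    then have "L +>\<^bsub>M\<^esub> (x \<ominus>\<^bsub>M\<^esub> b) = L +>\<^bsub>M\<^esub> ((a \<oplus>\<^bsub>M\<^esub> b) \<ominus>\<^bsub>M\<^esub> b)"
      using x ab coset_add_cong[OF L(1), of x "a \<oplus>\<^bsub>M\<^esub> b" "\<ominus>\<^bsub>M\<^esub> b" "\<ominus>\<^bsub>M\<^esub> b"] by (simp add: a_minus_def)
    also have "(a \<oplus>\<^bsub>M\<^esub> b) \<ominus>\<^bsub>M\<^esub> b = a"
      using ab by (simp add: a_minus_def M.a_assoc M.r_neg)
    finally have "x \<ominus>\<^bsub>M\<^esub> b \<in> pre P"
      using ab x pk(1) by (simp add: pre_def)
    moreover have "b \<in> pre K"
      using ab pk(2) by (simp add: pre_def)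
    moreover have "x = (x \<ominus>\<^bsub>M\<^esub> b) \<oplus>\<^bsub>M\<^esub> b"
      using ab x by (simp add: a_minus_def M.a_assoc M.l_neg)
    ultimately show "x \<in> pre P <+>\<^bsub>M\<^esub> pre K"
      unfolding mem_set_add by blast
  qed
  moreover have "pre P <+>\<^bsub>M\<^esub> pre K \<subseteq> carrier M"
    using set_add_least[OF submodule_carrier] by (auto simp: pre_def)
  moreover have "pre P \<inter> pre K = L"
  proof (rule subset_antisym)
    show "pre P \<inter> pre K \<subseteq> L"
      using int coset_eq_self_iff[OF L(1)] by (auto simp: pre_def)
    show "L \<subseteq> pre P \<inter> pre K"
    proof
      fix x assume "x \<in> L"
      moreover from this have "x \<in> carrier M"
        using submodule_subset[OF L(1)] by blast
      moreover from calculation have "L +>\<^bsub>M\<^esub> x = L"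
        using coset_eq_self_iff[OF L(1)] by blast
      ultimately show "x \<in> pre P \<inter> pre K"
        using sub(2)[OF P] sub(2)[OF K] by (simp add: pre_def)
    qed
  qed
  ultimately have "pre P = L \<or> pre K = L"
    using irred sub(3) P K by blast
  \<comment> \<open>A submodule of the quotient is determined by its preimage: if only elements of
    \<open>L\<close> map into \<open>T\<close>, then \<open>T\<close> is zero.\<close>
  moreover have "T = {L}" if T: "submodule T R ?Q" and "pre T = L" for T
  proof -
    have "t = L" if "t \<in> T" for t
    proof -
      have "t \<in> (\<lambda>x. L +>\<^bsub>M\<^esub> x) ` carrier M"
        using sub(1)[OF T] \<open>t \<in> T\<close> unfolding quotient_carrier by (rule subsetD)
      then obtain a where a: "a \<in> carrier M" "t = L +>\<^bsub>M\<^esub> a"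
        by (rule imageE)
      then have "a \<in> L"
        using \<open>pre T = L\<close> \<open>t \<in> T\<close> by (auto simp: pre_def)
      then show ?thesis
        using a coset_eq_self_iff[OF L(1)] by simp
    qed
    then show ?thesis
      using sub(2)[OF T] by blast
  qed
  ultimately show "P = {L} \<or> K = {L}"
    using P K by blast
qed

lemma submodule_of_submodule:
  assumes "submodule K R M" "submodule P R (M\<lparr>carrier := K\<rparr>)"
  shows "P \<subseteq> K" "submodule P R M"
proof -
  interpret P: submodule P R "M\<lparr>carrier := K\<rparr>" by fact
  show "P \<subseteq> K"
    using P.subset by simp
  then show "submodule P R M"
    using submodule_subset[OF assms(1)] P.one_closed P.m_closed P.smult_closed
    by (intro submoduleI) auto
qed

text \<open>\<open>K\<close> is isomorphic to M/L, but no isomorphism is set up: a decomposition of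
  \<open>K\<close> into \<open>P\<close> and \<open>Q\<close> yields L + P and L + Q, which sum to
  \<open>M\<close> and meet in \<open>L\<close>, so \<open>irred\<close> applies directly.\<close>

lemma indecomposable_complement:
  assumes LK: "complementary R M L K" and "L \<noteq> carrier M"
    and irred: "\<And>A B. \<lbrakk>submodule A R M; submodule B R M; A <+>\<^bsub>M\<^esub> B = carrier M; A \<inter> B = L\<rbrakk>
      \<Longrightarrow> A = L \<or> B = L"
  shows "indecomposable R (M\<lparr>carrier := K\<rparr>)"
proof -
  have L: "submodule L R M" and K: "submodule K R M" and sum: "L <+>\<^bsub>M\<^esub> K = carrier M"
    and int: "L \<inter> K = {\<zero>\<^bsub>M\<^esub>}"
    using LK by (auto simp: complementary_def)
  note LM = submodule_subset[OF L] and KM = submodule_subset[OF K]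
  have "K \<noteq> {\<zero>\<^bsub>M\<^esub>}"
  proof
    assume "K = {\<zero>\<^bsub>M\<^esub>}"
    then have "carrier M \<subseteq> L"
      using sum LM set_add_least[OF L, of L "{\<zero>\<^bsub>M\<^esub>}"] submodule_zero[OF L] by auto
    then show False
      using LM assms(2) by blast
  qed
  moreover have "P = {\<zero>\<^bsub>M\<^esub>} \<or> Q = {\<zero>\<^bsub>M\<^esub>}" if "complementary R (M\<lparr>carrier := K\<rparr>) P Q" for P Q
  proof -
    have "P <+>\<^bsub>M\<lparr>carrier := K\<rparr>\<^esub> Q = P <+>\<^bsub>M\<^esub> Q"
      by (simp add: set_add_def')
    then have PQ: "submodule P R (M\<lparr>carrier := K\<rparr>)" "submodule Q R (M\<lparr>carrier := K\<rparr>)"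
      "P <+>\<^bsub>M\<^esub> Q = K" "P \<inter> Q = {\<zero>\<^bsub>M\<^esub>}"
      using that by (auto simp: complementary_def)
    note P = submodule_of_submodule[OF K PQ(1)] and Q = submodule_of_submodule[OF K PQ(2)]
    note LP = submodule_set_add[OF L P(2)] and LQ = submodule_set_add[OF L Q(2)]
    have "K \<subseteq> (L <+>\<^bsub>M\<^esub> P) <+>\<^bsub>M\<^esub> (L <+>\<^bsub>M\<^esub> Q)"
      unfolding PQ(3)[symmetric]
      using set_add_upper[OF LP LQ] set_add_upper[OF L P(2)] set_add_upper[OF L Q(2)]
      by (intro set_add_least submodule_set_add LP LQ) auto
    moreover have "L \<subseteq> (L <+>\<^bsub>M\<^esub> P) <+>\<^bsub>M\<^esub> (L <+>\<^bsub>M\<^esub> Q)"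
      using set_add_upper[OF LP LQ] set_add_upper[OF L P(2)] by blast
    ultimately have "carrier M \<subseteq> (L <+>\<^bsub>M\<^esub> P) <+>\<^bsub>M\<^esub> (L <+>\<^bsub>M\<^esub> Q)"
      unfolding sum[symmetric] by (intro set_add_least submodule_set_add LP LQ)
    then have 1: "(L <+>\<^bsub>M\<^esub> P) <+>\<^bsub>M\<^esub> (L <+>\<^bsub>M\<^esub> Q) = carrier M"
      using submodule_subset[OF submodule_set_add[OF LP LQ]] by blast
    have 2: "(L <+>\<^bsub>M\<^esub> P) \<inter> (L <+>\<^bsub>M\<^esub> Q) = L"
    proof (rule subset_antisym)
      show "L \<subseteq> (L <+>\<^bsub>M\<^esub> P) \<inter> (L <+>\<^bsub>M\<^esub> Q)"
        using set_add_upper[OF L P(2)] set_add_upper[OF L Q(2)] by blast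
      show "(L <+>\<^bsub>M\<^esub> P) \<inter> (L <+>\<^bsub>M\<^esub> Q) \<subseteq> L"
      proof
        fix x assume "x \<in> (L <+>\<^bsub>M\<^esub> P) \<inter> (L <+>\<^bsub>M\<^esub> Q)"
        then obtain l p l' q where *: "l \<in> L" "p \<in> P" "l' \<in> L" "q \<in> Q" "x = l \<oplus>\<^bsub>M\<^esub> p" "l \<oplus>\<^bsub>M\<^esub> p = l' \<oplus>\<^bsub>M\<^esub> q"
          by (auto simp: mem_set_add)
        have M: "l \<in> carrier M" "l' \<in> carrier M" "p \<in> carrier M" "q \<in> carrier M"
          using * LM KM P(1) Q(1) by auto
        \<comment> \<open>From l + p = l' + q the difference p - q equals l' - l, so it lies in L
          \<inter> K = 0; then p = q lies in P \<inter> Q = 0.\<close>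
        have "p \<ominus>\<^bsub>M\<^esub> q = (\<ominus>\<^bsub>M\<^esub> l \<oplus>\<^bsub>M\<^esub> (l \<oplus>\<^bsub>M\<^esub> p)) \<ominus>\<^bsub>M\<^esub> q"
          using M by (simp add: M.r_neg1)
        also have "\<dots> = \<ominus>\<^bsub>M\<^esub> l \<oplus>\<^bsub>M\<^esub> l'"
          using M unfolding *(6) by (simp add: a_minus_def M.a_assoc M.r_neg)
        finally have "p \<ominus>\<^bsub>M\<^esub> q \<in> L"
          using * submodule_add[OF L] submodule_minus[OF L] by simp
        moreover have "p \<ominus>\<^bsub>M\<^esub> q \<in> K"
          using * P(1) Q(1) submodule_diff[OF K] by blast
        ultimately have "p \<ominus>\<^bsub>M\<^esub> q = \<zero>\<^bsub>M\<^esub>"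
          using int by blast
        moreover have "p = (p \<ominus>\<^bsub>M\<^esub> q) \<oplus>\<^bsub>M\<^esub> q"
          using M by (simp add: a_minus_def M.a_assoc M.l_neg)
        ultimately have "p = q"
          using M by simp
        then have "p = \<zero>\<^bsub>M\<^esub>"
          using * PQ(4) by blast
        then show "x \<in> L"
          using * M by simp
      qed
    qed
    \<comment> \<open>L + T = L forces \<open>T\<close> into \<open>L\<close>, while
      \<open>T\<close> also lies in the complement \<open>K\<close>.\<close>
    have triv: "T = {\<zero>\<^bsub>M\<^esub>}" if "submodule T R M" "T \<subseteq> K" "L <+>\<^bsub>M\<^esub> T = L" for T
      using that int set_add_upper[OF L that(1)] submodule_zero[OF that(1)] by blast
    show ?thesis
      using irred[OF LP LQ 1 2] triv P Q by blast
  qed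
  ultimately show ?thesis
    by (simp add: indecomposable_def)
qed

text \<open>The extension step for the second use of Zorn's lemma. \<open>K\<close> complements a
  possibly larger \<open>L\<close> and not \<open>N\<close>, so N + K may be smaller than
  \<open>M\<close>; its purity is what allows the step to be repeated.\<close>

lemma exists_indecomposable_extending_pure:
  assumes "\<And>X. X \<in> S \<Longrightarrow> left_module R X" "\<And>X. X \<in> S \<Longrightarrow> finitely_presented R X"
    and "\<And>L. \<lbrakk>pure S L; indecomposable R (quotient_module M L)\<rbrakk> \<Longrightarrow> direct_summand R M L"
    and "pure S N" "N \<noteq> carrier M"
  obtains K where "submodule K R M" "indecomposable R (M\<lparr>carrier := K\<rparr>)" "N \<inter> K = {\<zero>\<^bsub>M\<^esub>}"
    "pure S (N <+>\<^bsub>M\<^esub> K)"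
proof -
  have N: "submodule N R M"
    using assms(4) by (simp add: pure_def)
  then obtain x where x: "x \<in> carrier M" "x \<notin> N"
    using assms(5) submodule_subset by blast
  then obtain L where L: "pure S L" "N \<subseteq> L" "x \<notin> L" "\<And>A. \<lbrakk>pure S A; L \<subseteq> A; x \<notin> A\<rbrakk> \<Longrightarrow> A = L"
    using exists_maximal_pure[OF assms(1,2,4)] by metis
  have Lsub: "submodule L R M" "L \<noteq> carrier M"
    using L x by (auto simp: pure_def)
  note irred = maximal_pure_irreducible[OF assms(1) L(1,3,4)]
  have "direct_summand R M L"
    using indecomposable_quotient[OF Lsub irred] assms(3) L(1) by blast
  then obtain K where K: "complementary R M L K"
    by (auto simp: direct_summand_def)
  then have Ksub: "submodule K R M" and sum: "L <+>\<^bsub>M\<^esub> K = carrier M" and int: "L \<inter> K = {\<zero>\<^bsub>M\<^esub>}"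
    by (auto simp: complementary_def)
  note NK = submodule_set_add[OF N Ksub]
  have "L <+>\<^bsub>M\<^esub> K \<subseteq> (N <+>\<^bsub>M\<^esub> K) <+>\<^bsub>M\<^esub> L"
    using set_add_upper[OF NK Lsub(1)] set_add_upper[OF N Ksub]
    by (intro set_add_least submodule_set_add NK Lsub(1)) auto
  then have "(N <+>\<^bsub>M\<^esub> K) <+>\<^bsub>M\<^esub> L = carrier M"
    using sum submodule_subset[OF submodule_set_add[OF NK Lsub(1)]] by blast
  moreover have "(N <+>\<^bsub>M\<^esub> K) \<inter> L = N"
  proof -
    have "(N <+>\<^bsub>M\<^esub> K) \<inter> L = N <+>\<^bsub>M\<^esub> {\<zero>\<^bsub>M\<^esub>}"
      using modular_law[OF N Ksub Lsub(1) L(2)] int by (simp add: Int_commute)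
    also have "\<dots> = N"
      using set_add_least[OF N, of N "{\<zero>\<^bsub>M\<^esub>}"] set_add_upper[OF N submodule_zero_singleton]
        submodule_zero[OF N] by auto
    finally show ?thesis .
  qed
  \<comment> \<open>\<open>pure_of_complement_mod\<close> with N + K and \<open>L\<close> as the two
    submodules: they add up to \<open>M\<close> and meet in the pure submodule
    \<open>N\<close>.\<close>
  ultimately have "pure S (N <+>\<^bsub>M\<^esub> K)"
    using pure_of_complement_mod[OF assms(1,4) NK Lsub(1)] by blast
  moreover have "N \<inter> K = {\<zero>\<^bsub>M\<^esub>}"
    using int L(2) submodule_zero[OF N] submodule_zero[OF Ksub] by blast
  ultimately show thesis
    using that[OF Ksub indecomposable_complement[OF K Lsub(2) irred]] by blast
qed

section \<open>Independent families of submodules\<close>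

text \<open>The sum of a family, generated by adding one element of one member at a time. A member
  may be used repeatedly, which turns closure and chain arguments into plain inductions;
  \<open>sum_span_finsumE\<close> recovers sums with one term per member.\<close>

inductive_set sum_span :: "'m set set \<Rightarrow> 'm set" for D :: "'m set set"
  where
    zero: "\<zero>\<^bsub>M\<^esub> \<in> sum_span D"
  | add: "\<lbrakk>x \<in> sum_span D; K \<in> D; k \<in> K\<rbrakk> \<Longrightarrow> x \<oplus>\<^bsub>M\<^esub> k \<in> sum_span D"

text \<open>Zero is permitted as a member: for N = 0 the starting family consists of the zero
  submodule alone.\<close>

definition independent :: "'m set set \<Rightarrow> bool"
  where "independent D \<longleftrightarrow> (\<forall>K\<in>D. K \<inter> sum_span (D - {K}) \<subseteq> {\<zero>\<^bsub>M\<^esub>})"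

lemma sum_span_least:
  assumes "submodule W R M" "\<And>K. K \<in> D \<Longrightarrow> K \<subseteq> W"
  shows "sum_span D \<subseteq> W"
proof
  fix x assume "x \<in> sum_span D"
  then show "x \<in> W"
    by induction (use assms submodule_zero submodule_add in blast)+
qed

lemma sum_span_mono:
  assumes "D \<subseteq> E"
  shows "sum_span D \<subseteq> sum_span E"
proof
  fix x assume "x \<in> sum_span D"
  then show "x \<in> sum_span E"
    by induction (use assms sum_span.intros in blast)+
qed

lemma submodule_sum_span:
  assumes "\<And>K. K \<in> D \<Longrightarrow> submodule K R M"
  shows "submodule (sum_span D) R M"
proof (rule submoduleI)
  show sub: "sum_span D \<subseteq> carrier M"
    by (intro sum_span_least submodule_carrier submodule_subset assms)
  show "\<zero>\<^bsub>M\<^esub> \<in> sum_span D"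
    by (rule sum_span.zero)
  show "x \<oplus>\<^bsub>M\<^esub> y \<in> sum_span D" if "x \<in> sum_span D" "y \<in> sum_span D" for x y
    using that(2)
  proof induction
    case zero
    then show ?case
      using that(1) sub by auto
  next
    case (add y K k)
    then have "(x \<oplus>\<^bsub>M\<^esub> y) \<oplus>\<^bsub>M\<^esub> k = x \<oplus>\<^bsub>M\<^esub> (y \<oplus>\<^bsub>M\<^esub> k)"
      using that(1) sub submodule_subset[OF assms] by (intro M.a_assoc) auto
    then show ?case
      using sum_span.add[OF add.IH add.hyps(2,3)] by simp
  qed
  show "a \<odot>\<^bsub>M\<^esub> x \<in> sum_span D" if "a \<in> carrier R" "x \<in> sum_span D" for a x
    using that(2)
  proof induction
    case zero
    then show ?case
      using that(1) by (simp add: smult_r_zero sum_span.zero)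
  next
    case (add y K k)
    then have "a \<odot>\<^bsub>M\<^esub> (y \<oplus>\<^bsub>M\<^esub> k) = a \<odot>\<^bsub>M\<^esub> y \<oplus>\<^bsub>M\<^esub> a \<odot>\<^bsub>M\<^esub> k"
      using that(1) sub submodule_subset[OF assms] by (intro smult_r_distr) auto
    then show ?case
      using sum_span.add[OF add.IH add.hyps(2)] submodule_smult[OF assms] add.hyps that(1) by simp
  qed
qed

lemma sum_span_upper:
  assumes "\<And>K. K \<in> D \<Longrightarrow> submodule K R M" "K \<in> D"
  shows "K \<subseteq> sum_span D"
proof
  fix k assume "k \<in> K"
  moreover from this have "\<zero>\<^bsub>M\<^esub> \<oplus>\<^bsub>M\<^esub> k = k"
    using submodule_subset[OF assms(1)[OF assms(2)]] by auto
  ultimately show "k \<in> sum_span D"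
    using sum_span.add[OF sum_span.zero assms(2)] by metis
qed

lemma sum_span_insert:
  assumes "\<And>K. K \<in> D \<Longrightarrow> submodule K R M" "submodule K R M"
  shows "sum_span (insert K D) = sum_span D <+>\<^bsub>M\<^esub> K"
proof (rule subset_antisym)
  note D = submodule_sum_span[of D, OF assms(1)]
  show "sum_span (insert K D) \<subseteq> sum_span D <+>\<^bsub>M\<^esub> K"
    using set_add_upper[OF D assms(2)] sum_span_upper[of D, OF assms(1)]
    by (intro sum_span_least submodule_set_add D assms(2)) auto
  have ins: "\<And>L. L \<in> insert K D \<Longrightarrow> submodule L R M"
    using assms by blast
  show "sum_span D <+>\<^bsub>M\<^esub> K \<subseteq> sum_span (insert K D)"
    using sum_span_mono[of D "insert K D"] sum_span_upper[of "insert K D", OF ins]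
    by (intro set_add_least submodule_sum_span ins) auto
qed

text \<open>An element of a sum uses only finitely many members, and these all belong to one family
  of the chain.\<close>

lemma sum_span_Union_chain:
  assumes "C \<noteq> {}" "\<And>D E. \<lbrakk>D \<in> C; E \<in> C\<rbrakk> \<Longrightarrow> D \<subseteq> E \<or> E \<subseteq> D"
  shows "sum_span (\<Union>C) = \<Union>(sum_span ` C)"
proof (rule subset_antisym)
  show "\<Union>(sum_span ` C) \<subseteq> sum_span (\<Union>C)"
    using sum_span_mono by blast
  show "sum_span (\<Union>C) \<subseteq> \<Union>(sum_span ` C)"
  proof
    fix x assume "x \<in> sum_span (\<Union>C)"
    then show "x \<in> \<Union>(sum_span ` C)"
    proof induction
      case zero
      then show ?case
        using assms(1) sum_span.zero by blast
    next
      case (add x K k)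
      then obtain D E where DE: "D \<in> C" "E \<in> C" "x \<in> sum_span D" "K \<in> E"
        by blast
      then obtain F where "F \<in> C" "D \<subseteq> F" "E \<subseteq> F"
        using assms(2)[OF DE(1,2)] by blast
      moreover from this have "x \<oplus>\<^bsub>M\<^esub> k \<in> sum_span F"
        using DE add.hyps sum_span_mono by (blast intro: sum_span.add)
      ultimately show ?case
        by blast
    qed
  qed
qed

lemma independent_subset:
  assumes "independent D" "E \<subseteq> D"
  shows "independent E"
proof -
  have "sum_span (E - {K}) \<subseteq> sum_span (D - {K})" for K
    using assms(2) by (intro sum_span_mono) blast
  then show ?thesis
    using assms unfolding independent_def by blast
qed

text \<open>Let x in an old member \<open>L\<close> be w + k with w from the remaining old members
  and k in \<open>K\<close>. Then k = x - w lies in the old sum as well, so it is zero, and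
  independence of \<open>D\<close> at \<open>L\<close> finishes.\<close>

lemma independent_insert:
  assumes "\<And>L. L \<in> D \<Longrightarrow> submodule L R M" "submodule K R M" "independent D"
    and "sum_span D \<inter> K = {\<zero>\<^bsub>M\<^esub>}"
  shows "independent (insert K D)"
proof (cases "K \<in> D")
  case True
  then show ?thesis
    using assms(3) by (simp add: insert_absorb)
next
  case False
  show ?thesis
    unfolding independent_def
  proof
    fix L assume "L \<in> insert K D"
    then consider "L = K" | "L \<in> D" "L \<noteq> K"
      using False by blast
    then show "L \<inter> sum_span (insert K D - {L}) \<subseteq> {\<zero>\<^bsub>M\<^esub>}"
    proof cases
      case 1
      then show ?thesis
        using False assms(4) by auto
    next
      case 2
      have D': "\<And>L'. L' \<in> D - {L} \<Longrightarrow> submodule L' R M"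
        using assms(1) by blast
      have "insert K D - {L} = insert K (D - {L})"
        using 2 by blast
      then have eq: "sum_span (insert K D - {L}) = sum_span (D - {L}) <+>\<^bsub>M\<^esub> K"
        using sum_span_insert[of "D - {L}" K, OF D' assms(2)] by simp
      have LD: "L \<subseteq> sum_span D" and mono: "sum_span (D - {L}) \<subseteq> sum_span D"
        using sum_span_upper[of D, OF assms(1)] 2 sum_span_mono by blast+
      note sub = submodule_sum_span[of D, OF assms(1)]
      show ?thesis
      proof
        fix x assume x: "x \<in> L \<inter> sum_span (insert K D - {L})"
        then have "x \<in> sum_span (D - {L}) <+>\<^bsub>M\<^esub> K"
          using eq by blast
        then obtain w k where wk: "w \<in> sum_span (D - {L})" "k \<in> K" "x = w \<oplus>\<^bsub>M\<^esub> k"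
          unfolding mem_set_add by blast
        have wkM: "w \<in> carrier M" "k \<in> carrier M"
          using wk mono submodule_subset[OF sub] submodule_subset[OF assms(2)] by auto
        then have "k = x \<ominus>\<^bsub>M\<^esub> w"
          unfolding wk(3) by (simp add: a_minus_def M.a_ac M.r_neg)
        moreover have "x \<ominus>\<^bsub>M\<^esub> w \<in> sum_span D"
          using x wk LD mono by (intro submodule_diff[OF sub]) auto
        ultimately have "k = \<zero>\<^bsub>M\<^esub>"
          using wk(2) assms(4) by blast
        then have "x = w"
          using wk wkM by simp
        then show "x \<in> {\<zero>\<^bsub>M\<^esub>}"
          using x wk assms(3) 2 unfolding independent_def by blast
      qed
    qed
  qed
qed

text \<open>A dependence at \<open>K\<close> involves only finitely many further members, so it
  already occurs in one family of the chain that contains \<open>K\<close>.\<close>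

lemma independent_Union_chain:
  assumes "\<And>D E. \<lbrakk>D \<in> C; E \<in> C\<rbrakk> \<Longrightarrow> D \<subseteq> E \<or> E \<subseteq> D" "\<And>D. D \<in> C \<Longrightarrow> independent D"
  shows "independent (\<Union>C)"
  unfolding independent_def
proof (intro ballI subsetI)
  fix K x assume K: "K \<in> \<Union>C" and x: "x \<in> K \<inter> sum_span (\<Union>C - {K})"
  \<comment> \<open>Removing \<open>K\<close> from every family leaves a chain, so
    \<open>sum_span_Union_chain\<close> applies.\<close>
  have "\<Union>C - {K} = \<Union>((\<lambda>D. D - {K}) ` C)"
    by blast
  moreover have "sum_span (\<Union>((\<lambda>D. D - {K}) ` C)) = \<Union>(sum_span ` (\<lambda>D. D - {K}) ` C)"
  proof (rule sum_span_Union_chain)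
    show "(\<lambda>D. D - {K}) ` C \<noteq> {}"
      using K by blast
    fix D E assume "D \<in> (\<lambda>D. D - {K}) ` C" "E \<in> (\<lambda>D. D - {K}) ` C"
    then show "D \<subseteq> E \<or> E \<subseteq> D"
      using assms(1) by blast
  qed
  ultimately obtain D where D: "D \<in> C" "x \<in> sum_span (D - {K})"
    using x by auto
  obtain E where E: "E \<in> C" "K \<in> E"
    using K by blast
  obtain F where F: "F \<in> C" "D \<subseteq> F" "E \<subseteq> F"
    using assms(1)[OF D(1) E(1)] D(1) E(1) by blast
  have "sum_span (D - {K}) \<subseteq> sum_span (F - {K})"
    using F by (intro sum_span_mono) blast
  then show "x \<in> {\<zero>\<^bsub>M\<^esub>}"
    using assms(2)[OF F(1)] D E F x unfolding independent_def by blast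
qed

section \<open>From independence to unique finite sums\<close>

lemma finsum_mem_submodule:
  assumes "submodule W R M" "\<And>i. i \<in> A \<Longrightarrow> f i \<in> W"
  shows "finsum M f A \<in> W"
  using assms(2)
proof (induction A rule: infinite_finite_induct)
  case (insert i A)
  then have "f \<in> A \<rightarrow> carrier M" "f i \<in> carrier M"
    using submodule_subset[OF assms(1)] by auto
  then show ?case
    using insert submodule_add[OF assms(1)] by simp
\<comment> \<open>Over an infinite index set \<open>finsum\<close> is zero by convention.\<close>
qed (use submodule_zero[OF assms(1)] in \<open>simp_all add: M.finsum_infinite\<close>)

lemma sum_span_finsumE:
  assumes "\<And>K. K \<in> D \<Longrightarrow> submodule K R M" "x \<in> sum_span D"
  obtains f F where "finite F" "F \<subseteq> D" "\<And>K. K \<in> D \<Longrightarrow> f K \<in> K" "\<And>K. K \<in> D - F \<Longrightarrow> f K = \<zero>\<^bsub>M\<^esub>"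
    "x = finsum M f F"
proof -
  have "\<exists>f F. finite F \<and> F \<subseteq> D \<and> (\<forall>K\<in>D. f K \<in> K) \<and> (\<forall>K\<in>D - F. f K = \<zero>\<^bsub>M\<^esub>) \<and> x = finsum M f F"
    using assms(2)
  proof induction
    case zero
    have "finsum M (\<lambda>_. \<zero>\<^bsub>M\<^esub>) {} = \<zero>\<^bsub>M\<^esub>"
      by simp
    then show ?case
      using submodule_zero[OF assms(1)] by (intro exI[of _ "\<lambda>_. \<zero>\<^bsub>M\<^esub>"] exI[of _ "{}"]) auto
  next
    case (add x K k)
    then obtain f F where f: "finite F" "F \<subseteq> D" "\<forall>K\<in>D. f K \<in> K" "\<forall>K\<in>D - F. f K = \<zero>\<^bsub>M\<^esub>"
      "x = finsum M f F"
      by blast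
    have fM: "f L \<in> carrier M" if "L \<in> D" for L
      using that f(3) submodule_subset[OF assms(1)] by blast
    have k: "k \<in> carrier M"
      using add.hyps submodule_subset[OF assms(1)] by blast
    \<comment> \<open>\<open>h\<close> carries the new term \<open>k\<close> at position
      \<open>K\<close> only; adding it to \<open>f\<close> pointwise merges \<open>k\<close> with
      any term from \<open>K\<close> already present.\<close>
    define h where "h L = (if K = L then k else \<zero>\<^bsub>M\<^esub>)" for L
    have h: "h L \<in> L" if "L \<in> D" for L
      using that add.hyps(3) submodule_zero[OF assms(1)] by (auto simp: h_def)
    have "x = finsum M f (insert K F)"
      unfolding f(5) using f add.hyps fM by (intro M.add.finprod_mono_neutral_cong_left) auto
    moreover have "k = finsum M h (insert K F)"
      unfolding h_def using f(1) k M.finsum_singleton[of K "insert K F" "\<lambda>_. k"] by simp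
    moreover have "finsum M (\<lambda>L. f L \<oplus>\<^bsub>M\<^esub> h L) (insert K F) = finsum M f (insert K F) \<oplus>\<^bsub>M\<^esub> finsum M h (insert K F)"
      using f(2) add.hyps(2) fM k by (intro M.finsum_addf) (auto simp: h_def)
    ultimately have "x \<oplus>\<^bsub>M\<^esub> k = finsum M (\<lambda>L. f L \<oplus>\<^bsub>M\<^esub> h L) (insert K F)"
      by simp
    moreover have "f L \<oplus>\<^bsub>M\<^esub> h L = \<zero>\<^bsub>M\<^esub>" if "L \<in> D - insert K F" for L
      using that f(4) by (auto simp: h_def)
    moreover have "f L \<oplus>\<^bsub>M\<^esub> h L \<in> L" if "L \<in> D" for L
      using that f(3) h submodule_add[OF assms(1)] by blast
    ultimately show ?case
      using f(1,2) add.hyps(2)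
      by (intro exI[of _ "\<lambda>L. f L \<oplus>\<^bsub>M\<^esub> h L"] exI[of _ "insert K F"]) auto
  qed
  then show thesis
    using that by blast
qed

lemma diff_eq_diff_if_add_eq_add:
  assumes "a \<in> carrier M" "b \<in> carrier M" "s \<in> carrier M" "t \<in> carrier M"
    and "a \<oplus>\<^bsub>M\<^esub> s = b \<oplus>\<^bsub>M\<^esub> t"
  shows "a \<ominus>\<^bsub>M\<^esub> b = t \<ominus>\<^bsub>M\<^esub> s"
proof -
  have "a \<ominus>\<^bsub>M\<^esub> b = (a \<oplus>\<^bsub>M\<^esub> s) \<oplus>\<^bsub>M\<^esub> (\<ominus>\<^bsub>M\<^esub> b \<oplus>\<^bsub>M\<^esub> \<ominus>\<^bsub>M\<^esub> s)"
    using assms(1-4) by (simp add: a_minus_def M.a_ac M.r_neg M.r_neg1 M.r_neg2)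
  also have "\<dots> = (b \<oplus>\<^bsub>M\<^esub> \<ominus>\<^bsub>M\<^esub> b) \<oplus>\<^bsub>M\<^esub> (t \<oplus>\<^bsub>M\<^esub> \<ominus>\<^bsub>M\<^esub> s)"
    unfolding assms(5) using assms(1-4) by (simp add: M.a_ac)
  also have "\<dots> = t \<ominus>\<^bsub>M\<^esub> s"
    using assms(1-4) by (simp add: a_minus_def M.r_neg)
  finally show ?thesis .
qed

text \<open>Existence is \<open>sum_span_finsumE\<close>. For uniqueness, if two expansions differ
  at \<open>K\<close>, then f K - g K lies in \<open>K\<close> and, as the total sums are equal,
  also in the sum of the other members.\<close>

lemma internal_direct_sum_if_independent:
  assumes D: "\<And>K. K \<in> D \<Longrightarrow> submodule K R M" and "independent D" "sum_span D = carrier M"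
  shows "internal_direct_sum R M D (\<lambda>K. K)"
  unfolding internal_direct_sum_def
proof (intro conjI ballI D)
  note DM = submodule_subset[OF D]
  fix x assume "x \<in> carrier M"
  then have "x \<in> sum_span D"
    using assms(3) by simp
  then obtain f F where F: "finite F" "F \<subseteq> D" and f: "\<And>K. K \<in> D \<Longrightarrow> f K \<in> K"
    "\<And>K. K \<in> D - F \<Longrightarrow> f K = \<zero>\<^bsub>M\<^esub>" and x: "x = finsum M f F"
    using sum_span_finsumE[OF D] by metis
  have fM: "f K \<in> carrier M" if "K \<in> D" for K
    using f(1)[OF that] DM[OF that] by blast
  let ?supp = "\<lambda>f. {K \<in> D. f K \<noteq> \<zero>\<^bsub>M\<^esub>}"
  let ?P = "\<lambda>f. f \<in> (\<Pi>\<^sub>E K\<in>D. K) \<and> finite (?supp f) \<and> x = finsum M f (?supp f)"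
  show "\<exists>!f. ?P f"
  proof (rule ex_ex1I)
    let ?g = "restrict f D"
    \<comment> \<open>The support can be strictly smaller than \<open>F\<close>, as \<open>f\<close>
      may vanish at points of \<open>F\<close>; the sum is unaffected.\<close>
    have supp: "?supp ?g \<subseteq> F"
      using f(2) by auto
    then have "finite (?supp ?g)"
      using F(1) finite_subset by blast
    moreover have "finsum M ?g (?supp ?g) = finsum M f F"
      using F f(2) fM supp by (intro M.add.finprod_mono_neutral_cong_left) auto
    ultimately have "?P ?g"
      using f(1) x by auto
    then show "\<exists>f. ?P f"
      by blast
  next
    fix f g assume f: "?P f" and g: "?P g"
    \<comment> \<open>A common finite index set for both expansions; each is padded with zero
      terms.\<close>
    let ?F = "?supp f \<union> ?supp g"
    have fM: "f K \<in> carrier M" and gM: "g K \<in> carrier M" if "K \<in> D" for K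
      using f g that DM by (auto simp: PiE_iff)
    have fin: "finite ?F"
      using f g by blast
    have "finsum M f (?supp f) = finsum M f ?F" "finsum M g (?supp g) = finsum M g ?F"
      using fin fM gM by (auto intro!: M.add.finprod_mono_neutral_cong_left)
    then have eq: "finsum M f ?F = finsum M g ?F"
      using f g by simp
    have "f K = g K" if K: "K \<in> D" for K
    proof (rule ccontr)
      assume neq: "f K \<noteq> g K"
      then have KF: "K \<in> ?F"
        using K by auto
      let ?s = "finsum M f (?F - {K})" and ?t = "finsum M g (?F - {K})"
      have split: "finsum M h ?F = h K \<oplus>\<^bsub>M\<^esub> finsum M h (?F - {K})" if "\<And>K. K \<in> D \<Longrightarrow> h K \<in> carrier M" for h
      proof -
        have "finsum M h (insert K (?F - {K})) = h K \<oplus>\<^bsub>M\<^esub> finsum M h (?F - {K})"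
          using that K fin by (intro M.finsum_insert) auto
        then show ?thesis
          using KF by (simp only: insert_Diff)
      qed
      then have sum: "f K \<oplus>\<^bsub>M\<^esub> ?s = g K \<oplus>\<^bsub>M\<^esub> ?t"
        using eq split[of f, OF fM] split[of g, OF gM] by simp
      have D': "\<And>L. L \<in> D - {K} \<Longrightarrow> submodule L R M"
        using D by blast
      note W = submodule_sum_span[of "D - {K}", OF D']
      have "f L \<in> sum_span (D - {K})" "g L \<in> sum_span (D - {K})" if "L \<in> ?F - {K}" for L
      proof -
        have "L \<in> D - {K}" "f L \<in> L" "g L \<in> L"
          using that f g by (auto simp: PiE_iff)
        then show "f L \<in> sum_span (D - {K})" "g L \<in> sum_span (D - {K})"
          using sum_span_upper[of "D - {K}", OF D'] by blast+
      qed
      then have st: "?s \<in> sum_span (D - {K})" "?t \<in> sum_span (D - {K})"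
        by (auto intro!: finsum_mem_submodule[OF W])
      then have stM: "?s \<in> carrier M" "?t \<in> carrier M"
        using submodule_subset[OF W] by auto
      have "f K \<ominus>\<^bsub>M\<^esub> g K = ?t \<ominus>\<^bsub>M\<^esub> ?s"
        using diff_eq_diff_if_add_eq_add[OF fM[OF K] gM[OF K] stM sum] .
      then have "f K \<ominus>\<^bsub>M\<^esub> g K \<in> sum_span (D - {K})"
        using submodule_diff[OF W] st by simp
      moreover have "f K \<ominus>\<^bsub>M\<^esub> g K \<in> K"
        using submodule_diff[OF D[OF K]] f g K by (auto simp: PiE_iff)
      ultimately have "f K \<ominus>\<^bsub>M\<^esub> g K = \<zero>\<^bsub>M\<^esub>"
        using assms(2) K unfolding independent_def by blast
      moreover have "f K = (f K \<ominus>\<^bsub>M\<^esub> g K) \<oplus>\<^bsub>M\<^esub> g K"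
        using fM[OF K] gM[OF K] by (simp add: a_minus_def M.a_assoc M.l_neg)
      ultimately have "f K = g K"
        using gM[OF K] by simp
      then show False
        using neq by blast
    qed
    then show "f = g"
      using f g PiE_ext[of f D "\<lambda>K. K" g] by blast
  qed
qed

text \<open>Keeping \<open>N\<close> itself in the family, exempt from indecomposability, makes the
  other members add up to a complement of \<open>N\<close>.\<close>

lemma exists_independent_complement:
  assumes "\<And>X. X \<in> S \<Longrightarrow> left_module R X" "\<And>X. X \<in> S \<Longrightarrow> finitely_presented R X"
    and "\<And>L. \<lbrakk>pure S L; indecomposable R (quotient_module M L)\<rbrakk> \<Longrightarrow> direct_summand R M L"
    and "pure S N"
  obtains D where "N \<in> D" "\<And>K. K \<in> D \<Longrightarrow> submodule K R M"
    "\<And>K. K \<in> D - {N} \<Longrightarrow> indecomposable R (M\<lparr>carrier := K\<rparr>)"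
    "independent D" "sum_span D = carrier M"
proof -
  have N: "submodule N R M"
    using assms(4) by (simp add: pure_def)
  let ?Z = "{D. N \<in> D \<and> (\<forall>K\<in>D. submodule K R M) \<and>
    (\<forall>K\<in>D - {N}. indecomposable R (M\<lparr>carrier := K\<rparr>)) \<and> independent D \<and> pure S (sum_span D)}"
  have "\<exists>D\<in>?Z. \<forall>E\<in>?Z. D \<subseteq> E \<longrightarrow> E = D"
  proof (rule subset_Zorn_nonempty)
    have "sum_span {N} = N"
      using sum_span_least[OF N, of "{N}"] sum_span_upper[of "{N}" N] N by auto
    \<comment> \<open>Independence of \<open>{N}\<close> refers to the sum of the empty
      family.\<close>
    moreover have "sum_span {} \<subseteq> {\<zero>\<^bsub>M\<^esub>}"
      by (rule sum_span_least[OF submodule_zero_singleton]) simp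
    ultimately have "{N} \<in> ?Z"
      using N assms(4) by (auto simp: independent_def)
    then show "?Z \<noteq> {}"
      by blast
    fix C assume "C \<noteq> {}" "subset.chain ?Z C"
    then have C: "C \<noteq> {}" "C \<subseteq> ?Z" "\<And>D E. \<lbrakk>D \<in> C; E \<in> C\<rbrakk> \<Longrightarrow> D \<subseteq> E \<or> E \<subseteq> D"
      by (auto simp: subset_chain_def)
    have chain: "subset.chain {K. pure S K} (sum_span ` C)"
      unfolding subset_chain_def
    proof (intro conjI ballI)
      fix A B assume "A \<in> sum_span ` C" "B \<in> sum_span ` C"
      then obtain D E where "D \<in> C" "E \<in> C" "A = sum_span D" "B = sum_span E"
        by blast
      then show "A \<subseteq> B \<or> B \<subseteq> A"
        using C(3)[of D E] sum_span_mono by metis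
    qed (use C(2) in blast)
    have "pure S (\<Union>(sum_span ` C))"
      by (rule pure_Union_chain[OF assms(1,2)]) (use C(1) chain in simp_all)
    then have "pure S (sum_span (\<Union>C))"
      using sum_span_Union_chain[OF C(1,3)] by simp
    moreover have "independent (\<Union>C)"
      using C(2) by (intro independent_Union_chain C(3)) blast+
    ultimately show "\<Union>C \<in> ?Z"
      using C(1,2) by blast
  qed
  then obtain D where DZ: "D \<in> ?Z" and max: "\<forall>E\<in>?Z. D \<subseteq> E \<longrightarrow> E = D"
    by (rule bexE)
  have D: "N \<in> D" "\<And>K. K \<in> D \<Longrightarrow> submodule K R M"
    "\<And>K. K \<in> D - {N} \<Longrightarrow> indecomposable R (M\<lparr>carrier := K\<rparr>)" "independent D" "pure S (sum_span D)"
    using DZ by blast+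
  have "sum_span D = carrier M"
  proof (rule ccontr)
    assume "sum_span D \<noteq> carrier M"
    then obtain K where K: "submodule K R M" "indecomposable R (M\<lparr>carrier := K\<rparr>)"
      "sum_span D \<inter> K = {\<zero>\<^bsub>M\<^esub>}" "pure S (sum_span D <+>\<^bsub>M\<^esub> K)"
      using exists_indecomposable_extending_pure[OF assms(1-3) D(5)] by metis
    have "independent (insert K D)"
      using independent_insert[of D K, OF D(2) K(1) D(4) K(3)] by blast
    moreover have "pure S (sum_span (insert K D))"
      using sum_span_insert[of D K, OF D(2) K(1)] K(4) by simp
    ultimately have "insert K D \<in> ?Z"
      using D(1-3) K(1,2) by blast
    then have "insert K D = D"
      using max by blast
    \<comment> \<open>By maximality \<open>K\<close> already belongs to \<open>D\<close>, hence lies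
      inside the sum that it meets in zero; but an indecomposable module is nonzero.\<close>
    then have "K \<subseteq> sum_span D"
      using sum_span_upper[of D K, OF D(2)] by blast
    then have "K = {\<zero>\<^bsub>M\<^esub>}"
      using K(3) by blast
    then show False
      using K(2) by (simp add: indecomposable_def)
  qed
  then show thesis
    using that[of D] D by blast
qed

end

theorem theorem5p4:
  fixes R :: "('r, 'k) ring_scheme"
    and S :: "('r, 'x, 'o) module_scheme set"
    and M :: "('r, 'm, 'p) module_scheme"
  assumes "ring R"
    and "\<And>X. X \<in> S \<Longrightarrow> left_module R X"
    and "\<And>X. X \<in> S \<Longrightarrow> finitely_presented R X"
    and "left_module R M"
    and "\<And>M0. S_pure_submodule R S M M0 \<Longrightarrow> indecomposable R (quotient_module M M0) \<Longrightarrow>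
           direct_summand R M M0"
  shows "(\<forall>N. S_pure_submodule R S M N \<longrightarrow> direct_summand R M N) \<and>
         direct_sum_of_indecomposables R M"
proof -
  interpret left_module R M by fact
  note pure_iff = S_pure_submodule_iff_pure[of S, OF assms(2)]
  have summand: "direct_summand R M L"
    if "pure S L" "indecomposable R (quotient_module M L)" for L
    using that assms(5) pure_iff by blast
  note decomp = exists_independent_complement[where S = S, OF assms(2,3) summand]
  show ?thesis
  proof (intro conjI allI impI)
    fix N assume "S_pure_submodule R S M N"
    then have "pure S N"
      using pure_iff by blast
    then obtain D where D: "N \<in> D" "\<And>K. K \<in> D \<Longrightarrow> submodule K R M" "independent D"
      "sum_span D = carrier M"
      using decomp[of N] by metis
    have D': "\<And>K. K \<in> D - {N} \<Longrightarrow> submodule K R M"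
      using D(2) by blast
    \<comment> \<open>Independence at \<open>N\<close> says precisely that the sum of the other
      members meets \<open>N\<close> trivially.\<close>
    let ?W = "sum_span (D - {N})"
    have N: "submodule N R M" and W: "submodule ?W R M"
      using D(1,2) submodule_sum_span[of "D - {N}", OF D'] by blast+
    have "N <+>\<^bsub>M\<^esub> ?W = ?W <+>\<^bsub>M\<^esub> N"
      using N W submodule_subset set_add_commute by metis
    also have "\<dots> = carrier M"
      using sum_span_insert[of "D - {N}" N, OF D' N] D(1,4) by (simp add: insert_absorb)
    finally have "complementary R M N ?W"
      using N W D(1,3) submodule_zero[OF N] submodule_zero[OF W]
      unfolding complementary_def independent_def by blast
    then show "direct_summand R M N"
      unfolding direct_summand_def by blast
  next
    obtain D where D: "{\<zero>\<^bsub>M\<^esub>} \<in> D" "\<And>K. K \<in> D \<Longrightarrow> submodule K R M"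
      "\<And>K. K \<in> D - {{\<zero>\<^bsub>M\<^esub>}} \<Longrightarrow> indecomposable R (M\<lparr>carrier := K\<rparr>)"
      "independent D" "sum_span D = carrier M"
      using decomp[of "{\<zero>\<^bsub>M\<^esub>}"] pure_zero[of S, OF assms(2)] by metis
    \<comment> \<open>Zero is not indecomposable and has to leave the family; the sum stays the
      same.\<close>
    let ?D = "D - {{\<zero>\<^bsub>M\<^esub>}}"
    have D': "\<And>K. K \<in> ?D \<Longrightarrow> submodule K R M"
      using D(2) by blast
    have W: "submodule (sum_span ?D) R M"
      using submodule_sum_span[of ?D, OF D'] by blast
    have "sum_span D \<subseteq> sum_span ?D"
    proof (rule sum_span_least[OF W])
      fix K assume "K \<in> D"
      then show "K \<subseteq> sum_span ?D"
        using sum_span_upper[of ?D K, OF D'] submodule_zero[OF W] by blast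
    qed
    then have "sum_span ?D = carrier M"
      using D(5) submodule_subset[OF W] by blast
    moreover have "independent ?D"
      using independent_subset[OF D(4)] by blast
    ultimately have "internal_direct_sum R M ?D (\<lambda>K. K)"
      using internal_direct_sum_if_independent[of ?D, OF D'] by blast
    then show "direct_sum_of_indecomposables R M"
      unfolding direct_sum_of_indecomposables_def using D(3) by blast
  qed
qed

end
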